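(* Let $B\subseteq\mathbb{Z}$ be the set $\{0, 30, 60, 126, 180, 210, 220, 240, 300, 306, 330, 360, 375, 390, 480, 486, 510, 520, 540, 570, 660, 666, 690, 750, 780, 820, 825, 840, 846, 870\}$ and let $\mathcal{T}_B=\mathbb{Z}+\frac{1}{900}B\subseteq\mathbb{R}$. Then $\mathcal{T}_B$ has the universal spectrum $\Lambda_B=900\mathbb{Z}+B$.
   Context: A measurable set $\Omega\subseteq\mathbb{R}$ of finite positive Lebesgue measure tiles $\mathbb{R}$ by translations with tiling set $\mathcal{T}$ if $\Omega+\mathcal{T}=\mathbb{R}$ and $(\Omega+t)\cap(\Omega+t')$ has Lebesgue measure zero for all distinct $t,t'\in\mathcal{T}$. Such an $\Omega$ is a spectral set with spectrum $\Lambda$ (a discrete subset of $\mathbb{R}$) if the functions $e^{2\pi i\lambda x}$, $\lambda\in\Lambda$, restricted to $\Omega$ form an orthogonal basis of $L^2(\Omega)$. A set $\Lambda$ is a universal spectrum for a tiling set $\mathcal{T}$ if every set $\Omega$ that tiles $\mathbb{R}$ by translations with tiling set $\mathcal{T}$ is a spectral set with spectrum $\Lambda$. *)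

theory Defs
  imports "HOL-Analysis.Analysis"
begin

definition discrete_set :: "real set \<Rightarrow> bool" where
  "discrete_set \<Lambda> \<longleftrightarrow> (\<forall>x\<in>\<Lambda>. x isolated_in \<Lambda>)"

definition tiles_with :: "real set \<Rightarrow> real set \<Rightarrow> bool" where
  "tiles_with \<Omega> \<T> \<longleftrightarrow>
     \<Omega> \<in> sets lebesgue \<and> 0 < emeasure lebesgue \<Omega> \<and> emeasure lebesgue \<Omega> < \<infinity> \<and>
     (\<Union>t\<in>\<T>. (\<lambda>x. x + t) ` \<Omega>) = UNIV \<and>
     (\<forall>t\<in>\<T>. \<forall>t'\<in>\<T>. t \<noteq> t' \<longrightarrow>
        ((\<lambda>x. x + t) ` \<Omega> \<inter> (\<lambda>x. x + t') ` \<Omega>) \<in> null_sets lebesgue)"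

definition expo :: "real \<Rightarrow> real \<Rightarrow> complex" where
  "expo l x = exp (2 * of_real pi * \<i> * of_real (l * x))"

definition L2_inner :: "real set \<Rightarrow> (real \<Rightarrow> complex) \<Rightarrow> (real \<Rightarrow> complex) \<Rightarrow> complex" where
  "L2_inner \<Omega> f g = set_lebesgue_integral lebesgue \<Omega> (\<lambda>x. f x * cnj (g x))"

definition in_L2 :: "real set \<Rightarrow> (real \<Rightarrow> complex) \<Rightarrow> bool" where
  "in_L2 \<Omega> f \<longleftrightarrow> set_borel_measurable lebesgue \<Omega> f \<and>
     set_integrable lebesgue \<Omega> (\<lambda>x. (cmod (f x))\<^sup>2)"

text \<open>Omega is spectral with spectrum Lambda: the exponentials e_lambda, lambda in Lambda,
  restricted to Omega form an orthogonal basis of L^2(Omega), i.e. they are pairwise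
  orthogonal and complete (only the zero element of L^2(Omega) is orthogonal to all of them).\<close>
definition spectral_with :: "real set \<Rightarrow> real set \<Rightarrow> bool" where
  "spectral_with \<Omega> \<Lambda> \<longleftrightarrow>
     discrete_set \<Lambda> \<and>
     (\<forall>l\<in>\<Lambda>. \<forall>m\<in>\<Lambda>. l \<noteq> m \<longrightarrow> L2_inner \<Omega> (expo l) (expo m) = 0) \<and>
     (\<forall>f. in_L2 \<Omega> f \<longrightarrow> (\<forall>l\<in>\<Lambda>. L2_inner \<Omega> f (expo l) = 0) \<longrightarrow>
          (AE x in lebesgue. x \<in> \<Omega> \<longrightarrow> f x = 0))"

definition universal_spectrum :: "real set \<Rightarrow> real set \<Rightarrow> bool" where
  "universal_spectrum \<Lambda> \<T> \<longleftrightarrow> (\<forall>\<Omega>. tiles_with \<Omega> \<T> \<longrightarrow> spectral_with \<Omega> \<Lambda>)"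

definition B_set :: "int set" where
  "B_set = {0, 30, 60, 126, 180, 210, 220, 240, 300, 306, 330, 360, 375, 390, 480, 486,
            510, 520, 540, 570, 660, 666, 690, 750, 780, 820, 825, 840, 846, 870}"

definition T_B :: "real set" where
  "T_B = {of_int n + of_int b / 900 | n b. b \<in> B_set}"

definition Lambda_B :: "real set" where
  "Lambda_B = {900 * of_int n + of_int b | n b. b \<in> B_set}"

end

theory Submission
  imports Defs
begin

text \<open>Suppose that \<Omega> tiles with Z + B/N. For almost every x the fibre A of \<Omega> over x + (1/N)Z satisfies
  A + B + NZ = Z with uniqueness, so that the exponential sums of A and B multiply to 0 at every
  frequency k not divisible by N. If the sum of B does not vanish at the differences of L, the
  characters indexed by L are therefore orthogonal on A, and if card B * card L = N they are a basis
  of functions on A. Orthogonality on \<Omega> follows likewise from the fact that \<Omega> + B/N tiles with Z.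
  For completeness, a function orthogonal to all exponentials with frequencies in NZ + l has, after
  modulation by l, a vanishing periodization with period 1/N; that is, all coefficients of its
  restriction to almost every fibre vanish.

  For the given B = L and N = 900, the sum of B at k can only vanish if for each p in {2, 3, 5} either
  p does not divide k or p^2 divides k, which fails for all differences of elements of B.\<close>

section \<open>Exponentials\<close>

text \<open>Two points shape the analysis. Translates of a tile are disjoint only up to null sets,
  whereas the fibre argument needs exact tilings of Z; so a single null set invariant under
  translation by 1/N is removed, and each fibre is kept whole or dropped whole. And no Fourier
  theory of periodizations is invoked: vanishing against the exponentials with frequencies in NZ is
  extended to all bounded Borel multipliers of period 1/N, and the multiplier is then built from the
  periodizations of the function itself. Summing over L leaves the integral of a positive multiple
  of |g|^2. On the arithmetic side, N = 30^2 comes from card B * card L = N with L = B. The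
  splitting 30 = 20 + 5 + 3 + 2 of B leaves, at each frequency, an equation between at most a few
  numbers of modulus 1. Such equations are rigid enough to determine the phases, and this is where
  divisibility by p^2 comes from.\<close>

lemma expo_eq_cis: "expo l x = cis (2 * pi * (l * x))"
  by (simp add: expo_def cis_conv_exp mult_ac)

lemma expo_add: "expo l (x + y) = expo l x * expo l y"
  by (simp add: expo_eq_cis cis_mult algebra_simps)

lemma norm_expo [simp]: "norm (expo l x) = 1"
  by (simp add: expo_eq_cis)

lemma expo_nonzero [simp]: "expo l x \<noteq> 0"
  using norm_expo[of l x] by force

lemma expo_zero [simp]: "expo l 0 = 1" "expo 0 x = 1"
  by (simp_all add: expo_eq_cis)

lemma expo_power: "expo l x ^ n = expo l (real n * x)"
  by (induction n) (simp_all add: expo_add algebra_simps)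

lemma cnj_expo: "cnj (expo l x) = expo (- l) x"
  by (simp add: expo_eq_cis cis_cnj)

lemma expo_eq_1_iff: "expo l x = 1 \<longleftrightarrow> l * x \<in> \<int>"
proof -
  have "expo l x = 1 \<longleftrightarrow> (\<exists>n::int. 2 * pi * (l * x) = of_int (2 * n) * pi)"
    by (simp add: expo_eq_cis cis_conv_exp exp_eq_1)
  also have "\<dots> \<longleftrightarrow> l * x \<in> \<int>"
    by (auto simp: Ints_def)
  finally show ?thesis .
qed

lemma expo_frac_eq_1_iff:
  assumes "N \<noteq> 0"
  shows "expo (of_int k / of_int N) (of_int m) = 1 \<longleftrightarrow> N dvd k * m"
proof -
  have "of_int k / of_int N * of_int m = (of_int (k * m) / of_int N :: real)" by simp
  also have "\<dots> \<in> \<int> \<longleftrightarrow> N dvd k * m"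
  proof
    assume "of_int (k * m) / of_int N \<in> (\<int> :: real set)"
    then obtain n where "of_int (k * m) / of_int N = (of_int n :: real)" by (auto elim: Ints_cases)
    hence "of_int (k * m) = (of_int (n * N) :: real)" using assms by (simp add: field_simps)
    hence "k * m = n * N" by (simp only: of_int_eq_iff)
    thus "N dvd k * m" by simp
  next
    assume "N dvd k * m"
    then obtain n where "k * m = N * n" by blast
    thus "of_int (k * m) / of_int N \<in> (\<int> :: real set)"
      using assms by (simp only: of_int_mult) simp
  qed
  finally show ?thesis by (simp add: expo_eq_1_iff)
qed

lemma norm_1_cnj: "norm (z::complex) = 1 \<Longrightarrow> z * cnj z = 1"
  by (simp add: complex_norm_square[symmetric])

section \<open>Tilings of the integers\<close>

text \<open>Expanding squares, the sum of the squared moduli of all inner products of rows equals that of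
  all inner products of columns. In the square case the diagonal terms agree as well, so if the
  off-diagonal terms vanish on one side, they vanish on the other.\<close>
lemma unimodular_rows_orthogonal_imp_columns:
  fixes c :: "'a \<Rightarrow> 'b \<Rightarrow> complex"
  assumes fin: "finite A" "finite L" and card: "card A = card L"
    and norm: "\<And>a l. norm (c a l) = 1"
    and rows: "\<And>l l'. l \<in> L \<Longrightarrow> l' \<in> L \<Longrightarrow> l \<noteq> l' \<Longrightarrow> (\<Sum>a\<in>A. c a l * cnj (c a l')) = 0"
    and a: "a \<in> A" "a' \<in> A" "a \<noteq> a'"
  shows "(\<Sum>l\<in>L. c a l * cnj (c a' l)) = 0"
proof -
  define R where "R = (\<lambda>a a'. \<Sum>l\<in>L. c a l * cnj (c a' l))"
  define Q where "Q = (\<lambda>l l'. \<Sum>a\<in>A. c a l * cnj (c a l'))"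
  have sq: "complex_of_real ((norm z)\<^sup>2) = z * cnj z" for z by (simp only: complex_norm_square)
  have diagR: "R a a = of_nat (card L)" and diagQ: "Q l l = of_nat (card A)" for a l
    unfolding R_def Q_def by (simp_all add: norm_1_cnj norm)
  have "complex_of_real (\<Sum>a\<in>A. \<Sum>a'\<in>A. (norm (R a a'))\<^sup>2) =
      (\<Sum>a\<in>A. \<Sum>a'\<in>A. \<Sum>l\<in>L. \<Sum>l'\<in>L. c a l * cnj (c a' l) * (cnj (c a l') * c a' l'))"
    unfolding of_real_sum sq by (simp add: R_def sum_product)
  also have "\<dots> = (\<Sum>a\<in>A. \<Sum>l\<in>L. \<Sum>a'\<in>A. \<Sum>l'\<in>L. c a l * cnj (c a' l) * (cnj (c a l') * c a' l'))"
    by (rule sum.cong[OF refl], rule sum.swap)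
  also have "\<dots> = (\<Sum>l\<in>L. \<Sum>a\<in>A. \<Sum>l'\<in>L. \<Sum>a'\<in>A. c a l * cnj (c a' l) * (cnj (c a l') * c a' l'))"
    by (subst sum.swap) (intro sum.cong[OF refl], rule sum.swap)
  also have "\<dots> = (\<Sum>l\<in>L. \<Sum>l'\<in>L. \<Sum>a\<in>A. \<Sum>a'\<in>A. c a l * cnj (c a' l) * (cnj (c a l') * c a' l'))"
    by (rule sum.cong[OF refl], rule sum.swap)
  also have "\<dots> = complex_of_real (\<Sum>l\<in>L. \<Sum>l'\<in>L. (norm (Q l l'))\<^sup>2)"
    unfolding of_real_sum sq by (simp add: Q_def sum_product mult_ac)
  also have "(\<Sum>l\<in>L. \<Sum>l'\<in>L. (norm (Q l l'))\<^sup>2) = (\<Sum>l\<in>L. \<Sum>l'\<in>L. if l = l' then (real (card A))\<^sup>2 else 0)"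
    by (intro sum.cong refl) (auto simp: diagQ, auto simp: Q_def rows)
  also have "\<dots> = real (card L) * (real (card A))\<^sup>2" using fin by simp
  finally have total: "(\<Sum>a\<in>A. \<Sum>a'\<in>A. (norm (R a a'))\<^sup>2) = real (card L) * (real (card A))\<^sup>2"
    by (simp only: of_real_eq_iff)
  have "(\<Sum>a\<in>A. \<Sum>a'\<in>A. (norm (R a a'))\<^sup>2) = (\<Sum>a\<in>A. (real (card L))\<^sup>2 + (\<Sum>a'\<in>A - {a}. (norm (R a a'))\<^sup>2))"
    using fin by (intro sum.cong refl) (simp add: sum.remove diagR)
  also have "\<dots> = real (card L) * (real (card A))\<^sup>2 + (\<Sum>a\<in>A. \<Sum>a'\<in>A - {a}. (norm (R a a'))\<^sup>2)"
    by (simp add: sum.distrib card)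
  finally have "(\<Sum>a\<in>A. \<Sum>a'\<in>A - {a}. (norm (R a a'))\<^sup>2) = 0" using total by simp
  hence "\<forall>a\<in>A. (\<Sum>a'\<in>A - {a}. (norm (R a a'))\<^sup>2) = 0"
    using fin by (subst (asm) sum_nonneg_eq_0_iff) (auto intro: sum_nonneg)
  hence "(\<Sum>a'\<in>A - {a}. (norm (R a a'))\<^sup>2) = 0" using a by blast
  hence "\<forall>a'\<in>A - {a}. (norm (R a a'))\<^sup>2 = 0"
    using fin by (subst (asm) sum_nonneg_eq_0_iff) auto
  thus ?thesis using a by (auto simp: R_def)
qed

text \<open>A is a set of integers, not of residues: the fibres of a tile are not N-periodic. The
  second clause with b = b' makes distinct elements of A incongruent modulo N, so A and B are sets
  of representatives in a factorization of Z/N.\<close>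

definition int_tiling :: "nat \<Rightarrow> int set \<Rightarrow> int set \<Rightarrow> bool" where
  "int_tiling N A B \<longleftrightarrow>
     (\<forall>n. \<exists>a\<in>A. \<exists>b\<in>B. int N dvd n - (a + b)) \<and>
     (\<forall>a\<in>A. \<forall>b\<in>B. \<forall>a'\<in>A. \<forall>b'\<in>B. int N dvd (a + b) - (a' + b') \<longrightarrow> a = a' \<and> b = b')"

lemma int_tiling_bij:
  assumes "int_tiling N A B" "N > 0"
  shows "bij_betw (\<lambda>(a, b). (a + b) mod int N) (A \<times> B) {0..<int N}"
  unfolding bij_betw_def
proof
  show "inj_on (\<lambda>(a, b). (a + b) mod int N) (A \<times> B)"
    using assms unfolding int_tiling_def by (force simp: inj_on_def mod_eq_dvd_iff)
  show "(\<lambda>(a, b). (a + b) mod int N) ` (A \<times> B) = {0..<int N}"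
  proof (intro set_eqI iffI)
    fix n assume n: "n \<in> {0..<int N}"
    obtain a b where "a \<in> A" "b \<in> B" "int N dvd n - (a + b)"
      using assms unfolding int_tiling_def by metis
    moreover from this n have "n = (a + b) mod int N" by (simp add: mod_eq_dvd_iff[symmetric])
    ultimately show "n \<in> (\<lambda>(a, b). (a + b) mod int N) ` (A \<times> B)" by force
  qed (use assms in auto)
qed

lemma int_tiling_card:
  assumes "int_tiling N A B" "N > 0"
  shows "finite A" "card A * card B = N"
proof -
  note bij = int_tiling_bij[OF assms]
  have "finite (A \<times> B)" using bij_betw_finite[OF bij] by simp
  moreover have "A \<noteq> {}" "B \<noteq> {}" using assms unfolding int_tiling_def by blast+
  ultimately show "finite A" by (auto dest: finite_cartesian_productD1)
  show "card A * card B = N" using bij_betw_same_card[OF bij] by (simp add: card_cartesian_product)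
qed

text \<open>Through the bijection of A x B with the residues, the product becomes the sum of the
  character with frequency k/N over all of Z/N, a geometric sum with ratio different from 1.\<close>

lemma int_tiling_expo_sum:
  assumes tiling: "int_tiling N A B" and N: "N > 0" and k: "\<not> int N dvd k"
  shows "(\<Sum>a\<in>A. expo (of_int k / N) (of_int a)) * (\<Sum>b\<in>B. expo (of_int k / N) (of_int b)) = 0"
proof -
  define e where "e = (\<lambda>j::int. expo (of_int k / N) (of_int j))"
  have e1: "e j = 1 \<longleftrightarrow> int N dvd k * j" for j
    using expo_frac_eq_1_iff[of "int N" k j] N by (simp add: e_def)
  have add: "e (i + j) = e i * e j" for i j by (simp add: e_def expo_add)
  have emod: "e (j mod int N) = e j" for j
    using add[of "j mod int N" "int N * (j div int N)"] e1[of "int N * (j div int N)"] by simp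
  have pow: "e (int n) = e 1 ^ n" for n by (simp add: e_def expo_power)
  have "(\<Sum>a\<in>A. e a) * (\<Sum>b\<in>B. e b) = (\<Sum>p\<in>A \<times> B. e (case p of (a, b) \<Rightarrow> (a + b) mod int N))"
    by (simp add: sum_product sum.cartesian_product add emod case_prod_beta)
  also have "\<dots> = (\<Sum>n\<in>{0..<int N}. e n)"
    by (rule sum.reindex_bij_betw[OF int_tiling_bij[OF tiling N]])
  also have "\<dots> = (\<Sum>n<N. e (int n))"
    by (rule sum.reindex_bij_witness[of _ int nat]) auto
  also have "\<dots> = 0"
    using e1[of 1] e1[of "int N"] k unfolding pow by (subst geometric_sum) simp_all
  finally show ?thesis by (simp add: e_def)
qed

text \<open>In the vanishing product of the sums over A and B at frequency l - l', the factor of B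
  is nonzero, so the factor of A vanishes. This makes the matrix of the exponentials on A x L
  orthogonal in one direction; being square with entries of modulus 1, it is orthogonal in the
  other. That second direction recovers a function on A from its coefficients.\<close>

lemma int_tiling_dual_orthogonal:
  assumes tiling: "int_tiling N A B" and N: "N > 0"
    and L: "finite L" "card B * card L = N"
    and L_incong: "\<And>l l'. l \<in> L \<Longrightarrow> l' \<in> L \<Longrightarrow> int N dvd l - l' \<Longrightarrow> l = l'"
    and nonzero: "\<And>l l'. l \<in> L \<Longrightarrow> l' \<in> L \<Longrightarrow> l \<noteq> l' \<Longrightarrow>
      (\<Sum>b\<in>B. expo (of_int (l - l') / N) (of_int b)) \<noteq> 0"
    and a: "a \<in> A" "a' \<in> A"
  shows "(\<Sum>l\<in>L. expo (of_int l) (of_int (a - a') / N)) = (if a = a' then of_nat (card L) else 0)"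
proof (cases "a = a'")
  case False
  have card: "card A = card L"
    using int_tiling_card(2)[OF tiling N] L(2) N by (metis mult.commute mult_cancel1 mult_is_0 not_gr0)
  define c where "c = (\<lambda>(a::int) (l::int). expo (of_int l) (of_int a / N))"
  have "(\<Sum>l\<in>L. c a l * cnj (c a' l)) = 0"
  proof (rule unimodular_rows_orthogonal_imp_columns[OF int_tiling_card(1)[OF tiling N] L(1) card _ _ a False])
    fix l l' assume l: "l \<in> L" "l' \<in> L" "l \<noteq> l'"
    have "c a l * cnj (c a l') = expo (of_int (l - l') / N) (of_int a)" for a
      by (simp add: c_def expo_eq_cis cis_mult cis_cnj diff_divide_distrib algebra_simps)
    thus "(\<Sum>a\<in>A. c a l * cnj (c a l')) = 0"
      using int_tiling_expo_sum[OF tiling N, of "l - l'"] nonzero[OF l] L_incong[OF l(1,2)] l(3) by auto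
  qed (simp add: c_def)
  moreover have "c a l * cnj (c a' l) = expo (of_int l) (of_int (a - a') / N)" for l
    by (simp add: c_def expo_eq_cis cis_mult cis_cnj diff_divide_distrib algebra_simps)
  ultimately show ?thesis using False by simp
qed simp

section \<open>Vanishing Fourier coefficients\<close>

lemma expo_measurable [measurable]: "expo l \<in> borel_measurable borel"
  unfolding expo_def[abs_def] by measurable

lemma integrable_mult_bounded:
  fixes g h :: "'a \<Rightarrow> complex"
  assumes "integrable M g" "h \<in> borel_measurable M" "\<And>x. norm (h x) \<le> C"
  shows "integrable M (\<lambda>x. g x * h x)"
proof (rule Bochner_Integration.integrable_bound)
  show "integrable M (\<lambda>x. C * norm (g x))" using assms(1) by simp
  show "(\<lambda>x. g x * h x) \<in> borel_measurable M" using assms by simp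
  have "norm (g x * h x) \<le> norm (C * norm (g x))" for x
    using mult_right_mono[OF assms(3)[of x], of "norm (g x)"]
    by (simp add: norm_mult mult.commute)
  thus "AE x in M. norm (g x * h x) \<le> norm (C * norm (g x))" by simp
qed

text \<open>The Fourier coefficients of the periodization of g with period 1/c vanish.\<close>
definition expo_null :: "real \<Rightarrow> (real \<Rightarrow> complex) \<Rightarrow> bool" where
  "expo_null c g \<longleftrightarrow> integrable lborel g \<and> (\<forall>n::int. (\<integral>x. g x * expo (of_int n * c) x \<partial>lborel) = 0)"

lemma expo_null_integrable_expo:
  "expo_null c g \<Longrightarrow> integrable lborel (\<lambda>x. g x * expo l x)"
  unfolding expo_null_def by (rule integrable_mult_bounded[where C = 1]) auto

lemma expo_null_add:
  assumes "expo_null c f" "expo_null c g"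
  shows "expo_null c (\<lambda>x. f x + g x)"
  using assms expo_null_integrable_expo[OF assms(1)] expo_null_integrable_expo[OF assms(2)]
  by (simp add: expo_null_def distrib_right)

lemma expo_null_cmult:
  assumes "expo_null c f"
  shows "expo_null c (\<lambda>x. f x * a)"
proof -
  have *: "f x * a * e = (f x * e) * a" for x e by simp
  show ?thesis using assms unfolding expo_null_def * by simp
qed

lemma expo_null_expo:
  assumes "expo_null c f"
  shows "expo_null c (\<lambda>x. f x * expo (of_int m * c) x)"
proof -
  have *: "f x * expo (of_int m * c) x * expo (of_int n * c) x = f x * expo (of_int (m + n) * c) x" for x n
    by (simp add: expo_eq_cis cis_mult algebra_simps)
  show ?thesis
    using assms expo_null_integrable_expo[OF assms] unfolding expo_null_def * by blast
qed

text \<open>On the unit circle a polynomial is a trigonometric polynomial, and these only shift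
  frequencies by multiples of c. Keeping g arbitrary in the induction handles products: the second
  factor is applied to g times the first.\<close>

lemma expo_null_polynomial:
  assumes "real_polynomial_function p" "expo_null c g"
  shows "expo_null c (\<lambda>x. g x * of_real (p (expo c x)))"
  using assms
proof (induction arbitrary: g rule: real_polynomial_function.induct)
  case (linear f)
  interpret bounded_linear f by fact
  \<comment> \<open>Chosen so that f z = 2 Re (a z); on the circle \<open>cnj z\<close> is the
    exponential of the opposite frequency.\<close>
  define a where "a = (of_real (f 1) - \<i> * of_real (f \<i>)) / 2"
  have f: "complex_of_real (f z) = a * z + cnj a * cnj z" for z
  proof -
    have "z = Re z *\<^sub>R 1 + Im z *\<^sub>R \<i>" by (simp add: complex_eq_iff)
    hence "f z = f (Re z *\<^sub>R 1 + Im z *\<^sub>R \<i>)" by simp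
    also have "\<dots> = Re z * f 1 + Im z * f \<i>" by (simp only: add scale real_scaleR_def)
    finally show ?thesis by (simp add: a_def complex_eq_iff field_simps)
  qed
  have "g x * complex_of_real (f (expo c x)) =
      g x * expo (of_int 1 * c) x * a + g x * expo (of_int (-1) * c) x * cnj a" for x
    by (simp add: f cnj_expo algebra_simps)
  thus ?case using linear.prems by (simp add: expo_null_add expo_null_cmult expo_null_expo del: of_int_1 of_int_minus)
next
  case (add f g)
  then show ?case by (simp add: distrib_left expo_null_add)
next
  case (mult p q)
  show ?case using mult.IH(2)[OF mult.IH(1)[OF mult.prems]] by (simp add: mult.assoc)
qed (simp add: expo_null_cmult)

text \<open>By Stone-Weierstrass \<psi> is within e of a polynomial on the unit circle, the only
  place where it is evaluated. The error in the integral is then at most e times the L^1 norm of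
  g.\<close>

lemma expo_null_continuous:
  fixes \<psi> :: "complex \<Rightarrow> real"
  assumes g: "expo_null c g" and \<psi>: "continuous_on UNIV \<psi>"
  shows "(\<integral>x. g x * of_real (\<psi> (expo c x)) \<partial>lborel) = 0"
proof -
  have int: "integrable lborel g" using g by (simp add: expo_null_def)
  have [measurable]: "\<psi> \<in> borel_measurable borel" using \<psi> by (rule borel_measurable_continuous_onI)
  have "compact (\<psi> ` sphere 0 1)" using \<psi> by (intro compact_continuous_image) (auto intro: continuous_on_subset)
  then obtain C where C: "\<And>z. norm z = 1 \<Longrightarrow> \<bar>\<psi> z\<bar> \<le> C"
    using compact_imp_bounded[of "\<psi> ` sphere 0 1"] unfolding bounded_iff by (metis image_eqI mem_sphere_0 real_norm_def)
  have int\<psi>: "integrable lborel (\<lambda>x. g x * of_real (\<psi> (expo c x)))"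
    by (rule integrable_mult_bounded[OF int, where C = C]) (auto simp: C)
  define I where "I = (\<integral>x. norm (g x) \<partial>lborel)"
  have I: "I \<ge> 0" by (simp add: I_def)
  \<comment> \<open>The bound uses I + 1 so that it can be divided by even if I = 0.\<close>
  have "norm (\<integral>x. g x * of_real (\<psi> (expo c x)) \<partial>lborel) \<le> e * (I + 1)" if e: "e > 0" for e
  proof -
    obtain p where p: "real_polynomial_function p" "\<And>z. z \<in> sphere 0 1 \<Longrightarrow> \<bar>\<psi> z - p z\<bar> < e"
      using Stone_Weierstrass_real_polynomial_function[OF compact_sphere _ e, of "0::complex" 1 \<psi>] \<psi>
      by (metis continuous_on_subset subset_UNIV)
    note gp = expo_null_polynomial[OF p(1) g]
    have intp: "integrable lborel (\<lambda>x. g x * of_real (p (expo c x)))" using gp by (simp add: expo_null_def)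
    have "(\<integral>x. g x * of_real (p (expo c x)) * expo (of_int 0 * c) x \<partial>lborel) = 0"
      using gp unfolding expo_null_def by blast
    hence "(\<integral>x. g x * of_real (p (expo c x)) \<partial>lborel) = 0" by simp
    hence "(\<integral>x. g x * of_real (\<psi> (expo c x)) \<partial>lborel) =
       (\<integral>x. g x * of_real (\<psi> (expo c x)) - g x * of_real (p (expo c x)) \<partial>lborel)"
      using int\<psi> intp by simp
    also have "norm \<dots> \<le> (\<integral>x. e * norm (g x) \<partial>lborel)"
    proof (rule Bochner_Integration.integral_norm_bound_integral)
      fix x
      have "norm (g x * of_real (\<psi> (expo c x)) - g x * of_real (p (expo c x))) =
          norm (g x) * \<bar>\<psi> (expo c x) - p (expo c x)\<bar>"
        by (metis norm_mult norm_of_real of_real_diff right_diff_distrib)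
      also have "\<dots> \<le> norm (g x) * e" using p(2)[of "expo c x"] by (intro mult_left_mono) auto
      finally show "norm (g x * of_real (\<psi> (expo c x)) - g x * of_real (p (expo c x))) \<le> e * norm (g x)"
        by (simp add: mult.commute)
    qed (use int int\<psi> intp in auto)
    also have "\<dots> \<le> e * (I + 1)" using e by (simp add: I_def distrib_left)
    finally show ?thesis .
  qed
  from this[of "d / (I + 1)" for d] I have "norm (\<integral>x. g x * of_real (\<psi> (expo c x)) \<partial>lborel) \<le> 0 + d" if "d > 0" for d
    using that by simp
  hence "norm (\<integral>x. g x * of_real (\<psi> (expo c x)) \<partial>lborel) \<le> 0" by (rule field_le_epsilon)
  thus ?thesis by simp
qed

section \<open>From continuous functions on the circle to bounded Borel functions of the fractional
  part\<close>

lemma expo_eq_expo_frac: "expo c x = expo 1 (frac (c * x))"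
proof -
  have "expo 1 (frac (c * x)) * expo 1 (of_int \<lfloor>c * x\<rfloor>) = expo c x"
    unfolding expo_add[symmetric] by (simp add: frac_def expo_eq_cis)
  moreover have "expo 1 (of_int \<lfloor>c * x\<rfloor>) = 1" by (simp add: expo_eq_1_iff)
  ultimately show ?thesis by simp
qed

lemma expo_inj:
  assumes "expo 1 s = expo 1 t" "0 \<le> s" "s < 1" "0 \<le> t" "t < 1"
  shows "s = t"
proof -
  have "expo 1 (s - t) * expo 1 t = expo 1 s" unfolding expo_add[symmetric] by simp
  hence "s - t \<in> \<int>" using assms by (simp add: expo_eq_1_iff)
  then obtain n where n: "s - t = of_int n" by (auto elim: Ints_cases)
  with assms have "of_int n < (1::real)" "of_int n > (-1::real)" by linarith+
  hence "n = 0" by linarith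
  with n show ?thesis by simp
qed

lemma frac_measurable [measurable]: "(frac :: real \<Rightarrow> real) \<in> borel_measurable borel"
  unfolding frac_def[abs_def] by measurable

text \<open>Rays serve as the test sets because they are stable under intersection and generate the
  Borel sets.\<close>

lemma expo_null_ray:
  assumes g: "expo_null c g"
  shows "(\<integral>x. g x * indicator {a<..} (frac (c * x)) \<partial>lborel) = 0"
proof -
  consider "a < 0" | "a \<ge> 1" | "0 \<le> a" "a < 1" by linarith
  then show ?thesis
  proof cases
    case 1
    have "indicator {a<..} (frac (c * x)) = (1::complex)" for x
      using 1 frac_ge_0[of "c * x"] by (simp add: indicator_def less_le_trans del: frac_ge_0)
    moreover have "(\<integral>x. g x * expo (of_int 0 * c) x \<partial>lborel) = 0"
      using g unfolding expo_null_def by blast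
    ultimately show ?thesis by simp
  next
    case 2
    have "indicator {a<..} (frac (c * x)) = (0::complex)" for x
      using 2 frac_lt_1[of "c * x"] by (simp add: indicator_def)
    then show ?thesis by simp
  next
    case 3
    have int: "integrable lborel g" using g by (simp add: expo_null_def)
    \<comment> \<open>K is a closed arc, and its complement is where the fractional part exceeds a.
      The truncated multiples n * \<open>infdist z K\<close> are continuous and converge pointwise
      to the indicator of that complement, also near the end of the unit interval, where points of
      the circle come close to 1 in K.\<close>
    define K where "K = expo 1 ` {0..a}"
    have "compact K" unfolding K_def expo_def[abs_def]
      by (intro compact_continuous_image continuous_intros) auto
    hence K: "closed K" "K \<noteq> {}" using 3 by (auto simp: compact_imp_closed K_def)
    have in_K: "expo c x \<in> K \<longleftrightarrow> frac (c * x) \<le> a" for x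
    proof
      assume "expo c x \<in> K"
      then obtain s where s: "0 \<le> s" "s \<le> a" "expo 1 (frac (c * x)) = expo 1 s"
        unfolding K_def expo_eq_expo_frac[of c x] by auto
      with 3 have "frac (c * x) = s" by (intro expo_inj) (auto simp: frac_lt_1)
      with s show "frac (c * x) \<le> a" by simp
    next
      assume "frac (c * x) \<le> a"
      thus "expo c x \<in> K" unfolding K_def expo_eq_expo_frac[of c x] by auto
    qed
    define \<psi> where "\<psi> = (\<lambda>(n::nat) z. min 1 (real n * infdist z K))"
    have cont: "continuous_on UNIV (\<psi> n)" for n
      unfolding \<psi>_def by (intro continuous_intros)
    have [measurable]: "\<psi> n \<in> borel_measurable borel" for n
      using cont by (rule borel_measurable_continuous_onI)
    have bd: "norm (\<psi> n z) \<le> 1" for n z by (simp add: \<psi>_def infdist_nonneg)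
    have lim: "(\<lambda>n. \<psi> n (expo c x)) \<longlonglongrightarrow> indicator {a<..} (frac (c * x))" for x
    proof (cases "expo c x \<in> K")
      case True
      then show ?thesis using in_K[of x] by (simp add: \<psi>_def)
    next
      case False
      hence "infdist (expo c x) K > 0" using K in_closed_iff_infdist_zero infdist_nonneg
        by (metis antisym_conv2)
      then obtain n0 where "real n0 * infdist (expo c x) K > 1"
        using reals_Archimedean3 by blast
      hence "\<psi> n (expo c x) = 1" if "n \<ge> n0" for n
        using that mult_right_mono[of "real n0" "real n" "infdist (expo c x) K"]
        by (simp add: \<psi>_def infdist_nonneg)
      hence "(\<lambda>n. \<psi> n (expo c x)) \<longlonglongrightarrow> 1"
        by (intro tendsto_eventually eventually_sequentiallyI)
      with False in_K[of x] show ?thesis by simp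
    qed
    have "(\<lambda>n. \<integral>x. g x * of_real (\<psi> n (expo c x)) \<partial>lborel) \<longlonglongrightarrow>
        (\<integral>x. g x * of_real (indicator {a<..} (frac (c * x))) \<partial>lborel)"
    proof (rule integral_dominated_convergence[where w = "\<lambda>x. norm (g x)"])
      show "AE x in lborel. (\<lambda>n. g x * of_real (\<psi> n (expo c x))) \<longlonglongrightarrow>
          g x * of_real (indicator {a<..} (frac (c * x)))"
        by (intro AE_I2 tendsto_intros lim)
      show "AE x in lborel. norm (g x * of_real (\<psi> n (expo c x))) \<le> norm (g x)" for n
        using bd by (simp add: norm_mult mult_left_le)
    qed (use int in auto)
    hence "(\<integral>x. g x * of_real (indicator {a<..} (frac (c * x))) \<partial>lborel) = 0"
      unfolding expo_null_continuous[OF g cont] by (rule LIMSEQ_unique[OF _ tendsto_const])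
    moreover have "of_real (indicator {a<..} (frac (c * x))) = (indicator {a<..} (frac (c * x)) :: complex)" for x
      by (simp add: indicator_def)
    ultimately show ?thesis by simp
  qed
qed

text \<open>A Dynkin class argument from the rays. Complements use that the integral of g itself
  vanishes (frequency 0), and disjoint unions use countable additivity of the integral of g.\<close>

lemma expo_null_borel_set:
  assumes g: "expo_null c g" and S: "S \<in> sets borel"
  shows "(\<integral>x. g x * indicator S (frac (c * x)) \<partial>lborel) = 0"
proof -
  have int: "integrable lborel g" using g by (simp add: expo_null_def)
  hence [measurable]: "g \<in> borel_measurable borel" by simp
  let ?G = "range (\<lambda>a::real. {a<..})"
  have "{a<..} \<inter> {b<..} = {max a b<..}" for a b :: real by auto
  hence "Int_stable ?G" by (auto simp: Int_stable_def)
  have borel: "sigma_sets UNIV ?G = sets borel"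
    by (simp add: borel_Ioi)
  have "S \<in> sigma_sets UNIV ?G" using S borel by simp
  have "?G \<subseteq> Pow UNIV" by simp
  from \<open>Int_stable ?G\<close> this \<open>S \<in> sigma_sets UNIV ?G\<close> show ?thesis
  proof (induction rule: sigma_sets_induct_disjoint)
    case (basic A)
    then show ?case using expo_null_ray[OF g] by auto
  next
    case (compl A)
    hence [measurable]: "A \<in> sets borel" using borel by simp
    have "integrable lborel (\<lambda>x. g x * indicator A (frac (c * x)))"
      by (rule integrable_mult_bounded[OF int, where C = 1]) (auto simp: indicator_def)
    moreover have "(\<integral>x. g x * expo (of_int 0 * c) x \<partial>lborel) = 0"
      using g unfolding expo_null_def by blast
    moreover have "g x * indicator (UNIV - A) (frac (c * x)) = g x - g x * indicator A (frac (c * x))" for x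
      by (simp add: indicator_def)
    ultimately show ?case using int compl by simp
  next
    case (union A)
    have [measurable]: "A i \<in> sets borel" for i using union(2) borel by auto
    define A' where "A' = (\<lambda>i. (\<lambda>x. frac (c * x)) -` A i)"
    have [measurable]: "A' i \<in> sets borel" for i
      unfolding A'_def by (rule measurable_sets_borel[OF _ \<open>A i \<in> sets borel\<close>]) measurable
    have ind: "indicator X (frac (c * x)) = (indicator ((\<lambda>x. frac (c * x)) -` X) x :: complex)" for X x
      by (simp add: indicator_def)
    have un: "(\<lambda>x. frac (c * x)) -` (\<Union>i. A i) = (\<Union>i. A' i)" by (auto simp: A'_def)
    have "A' i \<inter> A' j = {}" if "i \<noteq> j" for i j
      using union(1) that by (auto simp: disjoint_family_on_def A'_def)
    hence "set_lebesgue_integral lborel (\<Union>i. A' i) g = (\<Sum>i. set_lebesgue_integral lborel (A' i) g)"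
      using int by (intro lebesgue_integral_countable_add)
        (auto simp: set_integrable_def intro!: integrable_mult_indicator)
    moreover have "set_lebesgue_integral lborel X g = (\<integral>x. g x * indicator X x \<partial>lborel)" for X
      unfolding set_lebesgue_integral_def
      by (intro Bochner_Integration.integral_cong) (auto simp: indicator_def)
    ultimately show ?case using union(3) unfolding ind un by (simp add: A'_def)
  qed simp
qed

text \<open>Rounding \<phi> down to multiples of 1/n gives a finite combination of indicators of
  Borel sets, and changes the integral by at most the L^1 norm of g divided by n.\<close>

lemma expo_null_bounded_real:
  fixes \<phi> :: "real \<Rightarrow> real"
  assumes g: "expo_null c g" and [measurable]: "\<phi> \<in> borel_measurable borel" and bd: "\<And>x. \<bar>\<phi> x\<bar> \<le> C"
  shows "(\<integral>x. g x * of_real (\<phi> (frac (c * x))) \<partial>lborel) = 0"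
proof -
  have int: "integrable lborel g" using g by (simp add: expo_null_def)
  hence [measurable]: "g \<in> borel_measurable borel" by simp
  have int\<phi>: "integrable lborel (\<lambda>x. g x * of_real (\<phi> (frac (c * x))))"
    by (rule integrable_mult_bounded[OF int, where C = C]) (auto simp: bd)
  define I where "I = (\<integral>x. norm (g x) \<partial>lborel)"
  have "norm (\<integral>x. g x * of_real (\<phi> (frac (c * x))) \<partial>lborel) \<le> I / real (Suc m)" for m
  proof -
    define n where "n = real (Suc m)"
    have n: "n > 0" by (simp add: n_def)
    \<comment> \<open>Contains every possible value of the floor of n * \<phi>, with a margin of one
      for the rounding.\<close>
    define D where "D = {- \<lceil>n * C\<rceil> - 1..\<lceil>n * C\<rceil> + 1}"
    define S where "S = (\<lambda>i::int. {y. \<lfloor>n * \<phi> y\<rfloor> = i})"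
    have S: "S i \<in> sets borel" for i unfolding S_def by measurable
    define s where "s = (\<lambda>x. \<Sum>i\<in>D. g x * indicator (S i) (frac (c * x)) * of_real (of_int i / n))"
    have intS: "integrable lborel (\<lambda>x. g x * indicator (S i) (frac (c * x)))" for i
      using S by (intro integrable_mult_bounded[OF int, where C = 1]) (auto simp: indicator_def)
    have ints: "integrable lborel s" unfolding s_def by (intro Bochner_Integration.integrable_sum integrable_mult_left intS)
    have s0: "(\<integral>x. s x \<partial>lborel) = 0"
      unfolding s_def using intS expo_null_borel_set[OF g S]
      by (subst Bochner_Integration.integral_sum) auto
    have s_eq: "s x = g x * of_real (of_int \<lfloor>n * \<phi> (frac (c * x))\<rfloor> / n)" for x
    proof -
      define y where "y = frac (c * x)"
      have "\<bar>n * \<phi> y\<bar> \<le> n * C" using bd[of y] n by (simp add: abs_mult)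
      hence "\<lfloor>n * \<phi> y\<rfloor> \<in> D" unfolding D_def atLeastAtMost_iff by linarith
      hence "(\<Sum>i\<in>D. g x * indicator (S i) y * of_real (of_int i / n)) =
          (\<Sum>i\<in>D. if i = \<lfloor>n * \<phi> y\<rfloor> then g x * of_real (of_int i / n) else 0)"
        by (intro sum.cong) (auto simp: S_def)
      also have "\<dots> = g x * of_real (of_int \<lfloor>n * \<phi> y\<rfloor> / n)"
        using \<open>\<lfloor>n * \<phi> y\<rfloor> \<in> D\<close> by (simp add: D_def)
      finally show ?thesis by (simp add: s_def y_def)
    qed
    have "(\<integral>x. g x * of_real (\<phi> (frac (c * x))) \<partial>lborel) =
        (\<integral>x. g x * of_real (\<phi> (frac (c * x))) - s x \<partial>lborel)"
      using int\<phi> ints s0 by simp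
    also have "norm \<dots> \<le> (\<integral>x. norm (g x) / n \<partial>lborel)"
    proof (rule Bochner_Integration.integral_norm_bound_integral)
      fix x
      define y where "y = frac (c * x)"
      have "g x * of_real (\<phi> y) - g x * of_real (of_int \<lfloor>n * \<phi> y\<rfloor> / n)
          = g x * of_real (\<phi> y - of_int \<lfloor>n * \<phi> y\<rfloor> / n)"
        unfolding of_real_diff right_diff_distrib ..
      hence "norm (g x * of_real (\<phi> y) - s x) = norm (g x) * \<bar>\<phi> y - of_int \<lfloor>n * \<phi> y\<rfloor> / n\<bar>"
        unfolding s_eq y_def[symmetric] by (simp only: norm_mult norm_of_real)
      also have "\<phi> y - of_int \<lfloor>n * \<phi> y\<rfloor> / n = frac (n * \<phi> y) / n"
        using n by (simp add: frac_def diff_divide_distrib)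
      also have "norm (g x) * \<bar>frac (n * \<phi> y) / n\<bar> \<le> norm (g x) * (1 / n)"
        using n frac_lt_1[of "n * \<phi> y"] by (intro mult_left_mono) (auto simp: divide_simps)
      finally show "norm (g x * of_real (\<phi> (frac (c * x))) - s x) \<le> norm (g x) / n"
        by (simp add: y_def)
    qed (use int int\<phi> ints in auto)
    also have "\<dots> = I / n" by (simp add: I_def)
    finally show ?thesis by (simp add: n_def)
  qed
  moreover have "(\<lambda>m. I / real (Suc m)) \<longlonglongrightarrow> 0"
    using LIMSEQ_Suc[OF lim_const_over_n[of I]] by simp
  ultimately have "norm (\<integral>x. g x * of_real (\<phi> (frac (c * x))) \<partial>lborel) \<le> 0"
    by (intro LIMSEQ_le_const[of _ 0]) auto
  thus ?thesis by simp
qed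

text \<open>This is the form used for completeness: the multiplier need only be bounded and Borel,
  so it may be constructed from g.\<close>

lemma expo_null_bounded:
  fixes \<phi> :: "real \<Rightarrow> complex"
  assumes g: "expo_null c g" and [measurable]: "\<phi> \<in> borel_measurable borel"
    and bd: "\<And>x. norm (\<phi> x) \<le> C"
  shows "(\<integral>x. g x * \<phi> (frac (c * x)) \<partial>lborel) = 0"
proof -
  have int: "integrable lborel g" using g by (simp add: expo_null_def)
  have bd': "\<bar>Re (\<phi> x)\<bar> \<le> C" "\<bar>Im (\<phi> x)\<bar> \<le> C" for x
    using bd[of x] abs_Re_le_cmod[of "\<phi> x"] abs_Im_le_cmod[of "\<phi> x"] by linarith+
  have "integrable lborel (\<lambda>x. g x * of_real (Re (\<phi> (frac (c * x)))))"
    "integrable lborel (\<lambda>x. g x * of_real (Im (\<phi> (frac (c * x)))))"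
    by (rule integrable_mult_bounded[OF int, where C = C]; simp add: bd')+
  moreover have "(\<integral>x. g x * of_real (Re (\<phi> (frac (c * x)))) \<partial>lborel) = 0"
    "(\<integral>x. g x * of_real (Im (\<phi> (frac (c * x)))) \<partial>lborel) = 0"
    by (rule expo_null_bounded_real[OF g, of "\<lambda>x. Re (\<phi> x)" C], simp_all add: bd')
      (rule expo_null_bounded_real[OF g, of "\<lambda>x. Im (\<phi> x)" C], simp_all add: bd')
  moreover have "g x * \<phi> y = g x * of_real (Re (\<phi> y)) + g x * of_real (Im (\<phi> y)) * \<i>" for x y
    by (subst complex_eq[of "\<phi> y"]) (simp add: algebra_simps)
  ultimately show ?thesis by simp
qed

section \<open>Tilings of the line\<close>

lemma cnj_measurable [measurable (raw)]:
  "f \<in> borel_measurable M \<Longrightarrow> (\<lambda>x. cnj (f x)) \<in> borel_measurable M"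
  by (rule borel_measurable_continuous_on[of cnj]) (auto intro: continuous_intros)

text \<open>W is a Borel version of a tile; outside of the null set Z, which is invariant under
  translation by 1/N, each fibre of W over a coset of (1/N)Z is an exact tile of the integers.\<close>
locale fibre_tiling =
  fixes N :: nat and B :: "int set" and W Z :: "real set"
  assumes N_pos: "N > 0"
    and W_borel [measurable]: "W \<in> sets borel"
    and W_finite: "emeasure lborel W < \<infinity>"
    and Z_null: "Z \<in> null_sets lborel"
    and Z_shift: "x + of_int j / real N \<in> Z \<longleftrightarrow> x \<in> Z"
    and W_Z: "W \<inter> Z = {}"
    and tiling: "x \<notin> Z \<Longrightarrow> int_tiling N {j. x + of_int j / real N \<in> W} B"
begin

lemma Z_borel [measurable]: "Z \<in> sets borel"
  using Z_null by (auto simp: null_sets_def)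

lemma Z_shift_diff: "x - of_int j / real N \<in> Z \<longleftrightarrow> x \<in> Z"
  using Z_shift[of x "- j"] by simp

lemma Z_shift_int: "x + of_int n \<in> Z \<longleftrightarrow> x \<in> Z"
  using Z_shift[of x "n * int N"] N_pos by simp

text \<open>A null set omits some point x, and there card A * card B = N > 0, while
  \<open>card\<close> is 0 on infinite sets.\<close>

lemma finite_B: "finite B"
proof (rule ccontr)
  assume "infinite B"
  have "emeasure lborel Z = 0" using Z_null by (rule null_setsD1)
  hence "Z \<noteq> UNIV" by (cases "Z = UNIV") simp_all
  then obtain x where "x \<notin> Z" by blast
  from int_tiling_card(2)[OF tiling[OF this] N_pos] \<open>infinite B\<close> N_pos show False by simp
qed

text \<open>The set W + B/N, which up to the null set Z is a fundamental domain of R modulo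
  Z.\<close>

definition U :: "real set" where "U = (\<Union>b\<in>B. {x. x - of_int b / real N \<in> W})"

lemma U_borel [measurable]: "U \<in> sets borel"
proof -
  have "(\<lambda>x. x - c) -` W \<in> sets borel" for c
    by (rule measurable_sets_borel[OF _ W_borel]) measurable
  hence "(\<Union>b\<in>B. (\<lambda>x. x - of_int b / real N) -` W) \<in> sets borel"
    using finite_B by (intro sets.finite_UN)
  thus ?thesis by (simp only: U_def vimage_def)
qed

text \<open>The translates of W by B/N are disjoint at every point, not just almost everywhere,
  because W avoids Z and the fibres outside Z are exact tiles.\<close>

lemma indicator_U: "(\<Sum>b\<in>B. indicator W (x - of_int b / real N)) = (indicator U x :: complex)"
proof (cases "x \<in> U")
  case True
  then obtain b where b: "b \<in> B" "x - of_int b / real N \<in> W" by (auto simp: U_def)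
  hence "x \<notin> Z" using W_Z Z_shift_diff[of x b] by blast
  have uniq: "b' = b" if "b' \<in> B" "x - of_int b' / real N \<in> W" for b'
  proof -
    \<comment> \<open>Both - b + b and - b' + b' are 0, so uniqueness in the tiling by the fibre
      over x gives b = b'.\<close>
    have "- b \<in> {j. x + of_int j / real N \<in> W}" "- b' \<in> {j. x + of_int j / real N \<in> W}" using b that by auto
    from tiling[OF \<open>x \<notin> Z\<close>, unfolded int_tiling_def, THEN conjunct2, rule_format,
        OF this(1) b(1) this(2) that(1)]
    show ?thesis by simp
  qed
  have "(\<Sum>b'\<in>B. indicator W (x - of_int b' / real N)) = (\<Sum>b'\<in>B. if b' = b then 1 else 0 :: complex)"
  proof (rule sum.cong[OF refl])
    fix b' assume "b' \<in> B"
    show "indicator W (x - of_int b' / real N) = (if b' = b then 1 else 0 :: complex)"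
    proof (cases "b' = b")
      case False
      hence "x - of_int b' / real N \<notin> W" using uniq[OF \<open>b' \<in> B\<close>] by blast
      thus ?thesis using False by simp
    qed (use b(2) in simp)
  qed
  thus ?thesis using True b finite_B by simp
next
  case False
  thus ?thesis by (auto simp: U_def indicator_def intro!: sum.neutral)
qed

text \<open>The point x + n lies in U exactly if N * n is a sum of elements of the fibre and of B.
  The residue 0 modulo N is represented by exactly one such sum.\<close>

lemma U_fundamental:
  assumes "x \<notin> Z"
  shows "\<exists>!n::int. x + of_int n \<in> U"
proof -
  let ?A = "{j. x + of_int j / real N \<in> W}"
  have mem: "x + of_int n \<in> U \<longleftrightarrow> (\<exists>b\<in>B. int N * n - b \<in> ?A)" for n
  proof -
    have "x + of_int n - of_int b / real N = x + of_int (int N * n - b) / real N" for b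
      using N_pos by (simp add: field_simps)
    thus ?thesis by (simp only: U_def UN_iff mem_Collect_eq)
  qed
  note t = tiling[OF assms, unfolded int_tiling_def]
  obtain a b where ab: "a \<in> ?A" "b \<in> B" "int N dvd 0 - (a + b)"
    using t[THEN conjunct1, rule_format, of 0] by blast
  then obtain m where "0 - (a + b) = int N * m" by blast
  hence "a = int N * (- m) - b" by simp
  hence ex: "x + of_int (- m) \<in> U" using ab(1,2) by (subst mem) auto
  have "n = n'" if n: "x + of_int n \<in> U" "x + of_int n' \<in> U" for n n'
  proof -
    obtain b b' where b: "b \<in> B" "int N * n - b \<in> ?A" "b' \<in> B" "int N * n' - b' \<in> ?A"
      using n[unfolded mem] by (elim bexE)
    have "(int N * n - b + b) - (int N * n' - b' + b') = int N * (n - n')"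
      by (simp add: right_diff_distrib)
    hence "int N dvd (int N * n - b + b) - (int N * n' - b' + b')" by (simp only: dvd_triv_left)
    from t[THEN conjunct2, rule_format, OF b(2,1,4,3) this] have "int N * n = int N * n'" by linarith
    thus ?thesis using N_pos by simp
  qed
  from ex this[OF _ ex] show ?thesis by (rule ex1I)
qed

text \<open>U is cut into its parts A i between consecutive integers, and C i is such a part moved
  to [0, 1). By \<open>U_fundamental\<close> the C i partition [0, 1) outside Z.
  \<open>int_decode\<close> enumerates the integers, which makes both partitions sequences.\<close>

lemma integral_U_periodic:
  fixes f :: "real \<Rightarrow> complex"
  assumes [measurable]: "f \<in> borel_measurable borel"
    and int01: "set_integrable lborel {0..1} f" and intU: "set_integrable lborel U f"
    and per: "\<And>x n. f (x + of_int n) = f x"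
  shows "(LINT x:U|lborel. f x) = (LINT x:{0..1}|lborel. f x)"
proof -
  define A where "A = (\<lambda>i. U \<inter> {x. \<lfloor>x\<rfloor> = int_decode i})"
  define C where "C = (\<lambda>i. {x \<in> {0..<1}. x + of_int (int_decode i) \<in> U})"
  have "x \<in> A (int_encode \<lfloor>x\<rfloor>)" if "x \<in> U" for x using that by (simp add: A_def)
  moreover have "A i \<subseteq> U" for i by (simp add: A_def)
  ultimately have Un_A: "U = (\<Union>i. A i)" by blast
  have [measurable]: "A i \<in> sets borel" for i unfolding A_def by measurable
  have vU: "(\<lambda>x. x + c) -` U \<in> sets borel" for c
    by (rule measurable_sets_borel[OF _ U_borel]) measurable
  have "C i = {0..<1} \<inter> (\<lambda>x. x + of_int (int_decode i)) -` U" for i by (auto simp: C_def)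
  hence [measurable]: "C i \<in> sets borel" for i using vU by simp
  have U_Z: "x \<notin> Z" if U: "x + of_int n \<in> U" for x n
  proof -
    obtain b where "x + of_int n - of_int b / real N \<in> W" using U by (auto simp: U_def)
    thus ?thesis using W_Z Z_shift_diff[of "x + of_int n" b] Z_shift_int[of x n] by blast
  qed
  have disj_A: "A i \<inter> A j = {}" if "i \<noteq> j" for i j
    using that by (auto simp: A_def int_decode_eq)
  have disj_C: "C i \<inter> C j = {}" if "i \<noteq> j" for i j
  proof (rule ccontr)
    assume "C i \<inter> C j \<noteq> {}"
    then obtain x where x: "x + of_int (int_decode i) \<in> U" "x + of_int (int_decode j) \<in> U"
      by (auto simp: C_def)
    have "int_decode i = int_decode j" using U_fundamental[OF U_Z[OF x(1)]] x by blast
    with that show False by (simp add: int_decode_eq)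
  qed
  have Un_C: "(\<Union>i. C i) = {0..<1} - Z"
  proof (intro set_eqI iffI)
    fix x assume "x \<in> (\<Union>i. C i)"
    thus "x \<in> {0..<1} - Z" using U_Z by (auto simp: C_def)
  next
    fix x assume x: "x \<in> {0..<1} - Z"
    then obtain n where "x + of_int n \<in> U" using U_fundamental[of x] by blast
    with x show "x \<in> (\<Union>i. C i)" by (auto simp: C_def intro!: exI[of _ "int_encode n"])
  qed
  have AC: "(LINT x:A i|lborel. f x) = (LINT x:C i|lborel. f x)" for i
  proof -
    let ?n = "real_of_int (int_decode i)"
    have "(LINT x:A i|lborel. f x) = (\<integral>x. indicator (A i) (?n + 1 * x) *\<^sub>R f (?n + 1 * x) \<partial>lborel)"
      unfolding set_lebesgue_integral_def by (subst lborel_integral_real_affine[where c = 1 and t = ?n]) simp_all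
    also have "\<dots> = (\<integral>x. indicator (C i) x *\<^sub>R f x \<partial>lborel)"
    proof (intro Bochner_Integration.integral_cong refl)
      fix x
      have "\<lfloor>?n + x\<rfloor> = int_decode i \<longleftrightarrow> x \<in> {0..<1}" by (auto simp: floor_eq_iff)
      hence "?n + x \<in> A i \<longleftrightarrow> x \<in> C i" by (auto simp: A_def C_def add.commute)
      thus "indicator (A i) (?n + 1 * x) *\<^sub>R f (?n + 1 * x) = indicator (C i) x *\<^sub>R f x"
        using per[of x "int_decode i"] by (simp add: indicator_def add.commute)
    qed
    finally show ?thesis by (simp add: set_lebesgue_integral_def)
  qed
  have intC: "set_integrable lborel ({0..<1} - Z) f"
    by (rule set_integrable_subset[OF int01]) auto
  have "(LINT x:U|lborel. f x) = (\<Sum>i. LINT x:A i|lborel. f x)"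
    unfolding Un_A by (rule lebesgue_integral_countable_add) (use disj_A intU Un_A in auto)
  also have "\<dots> = (\<Sum>i. LINT x:C i|lborel. f x)" by (simp add: AC)
  also have "\<dots> = (LINT x:(\<Union>i. C i)|lborel. f x)"
    by (rule lebesgue_integral_countable_add[symmetric]) (use disj_C intC Un_C in auto)
  also have "\<dots> = (LINT x:{0..1}|lborel. f x)"
    unfolding Un_C set_lebesgue_integral_def
  proof (rule integral_cong_AE)
    have "AE x in lborel. x \<noteq> (1::real)" by (rule AE_lborel_singleton)
    moreover have "AE x in lborel. x \<notin> Z" using Z_null by (rule AE_not_in)
    ultimately show "AE x in lborel. indicator ({0..<1} - Z) x *\<^sub>R f x = indicator {0..1} x *\<^sub>R f x"
      by eventually_elim (auto simp: indicator_def)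
  qed measurable
  finally show ?thesis .
qed

end

lemma integral_expo_unit_interval:
  assumes "k \<noteq> (0::int)"
  shows "(LINT x:{0..1}|lborel. expo (of_int k) x) = 0"
proof -
  define a where "a = 2 * complex_of_real pi * \<i> * of_int k"
  have a: "a \<noteq> 0" using assms by (simp add: a_def)
  have e: "expo (of_int k) x = exp (a * of_real x)" for x by (simp add: expo_def a_def mult_ac)
  have "(\<integral>x. indicator {0..1} x *\<^sub>R expo (of_int k) x \<partial>lborel) = exp (a * of_real 1) / a - exp (a * of_real 0) / a"
  proof (rule integral_FTC_Icc)
    fix x :: real
    have "((\<lambda>z. exp (a * z) / a) has_field_derivative exp (a * of_real x)) (at (of_real x))"
      using a by (auto intro!: derivative_eq_intros)
    hence "((\<lambda>x. exp (a * of_real x) / a) has_vector_derivative exp (a * of_real x)) (at x)"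
      by (rule has_vector_derivative_real_field)
    thus "((\<lambda>x. exp (a * of_real x) / a) has_vector_derivative expo (of_int k) x) (at x within {0..1})"
      unfolding e by (rule has_vector_derivative_at_within)
  qed (unfold e, auto intro!: continuous_intros)
  also have "exp (a * of_real 1) = expo (of_int k) 1" by (simp add: e)
  also have "\<dots> = 1" by (simp add: expo_eq_1_iff)
  finally show ?thesis by (simp add: set_lebesgue_integral_def)
qed

lemma set_integrable_expo:
  assumes [measurable]: "S \<in> sets borel" and "emeasure lborel S < \<infinity>"
  shows "set_integrable lborel S (expo l)"
  unfolding set_integrable_def
proof (rule Bochner_Integration.integrable_bound)
  show "integrable lborel (indicator S :: real \<Rightarrow> real)"
    using assms by (simp add: integrable_indicator_iff)
qed (auto simp: indicator_def)

section \<open>Orthogonality and completeness on the Borel tile\<close>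

context fibre_tiling
begin

text \<open>Translating W by b/N multiplies its integral by a phase, so the integral over U is the
  exponential sum of B times the integral over W. As the exponential has period 1, U may be replaced
  by [0, 1], where the integral is 0.\<close>

lemma integral_W_expo:
  assumes k: "k \<noteq> (0::int)" and nonzero: "(\<Sum>b\<in>B. expo (of_int k / N) (of_int b)) \<noteq> 0"
  shows "(LINT x:W|lborel. expo (of_int k) x) = 0"
proof -
  let ?e = "expo (of_int k)" and ?h = "\<lambda>b. of_int b / real N"
  have W_eq: "indicator W x *\<^sub>R ?e x = indicator W x * ?e x" for x by (simp add: indicator_def)
  have int: "integrable lborel (\<lambda>x. indicator W x * ?e x)"
    using set_integrable_expo[OF W_borel W_finite, of "of_int k"] by (simp add: set_integrable_def W_eq)
  have shift: "(\<integral>x. indicator W (x - ?h b) * ?e x \<partial>lborel) = ?e (?h b) * (\<integral>x. indicator W x * ?e x \<partial>lborel)"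
    and int_shift: "integrable lborel (\<lambda>x. indicator W (x - ?h b) * ?e x)" for b
  proof -
    have *: "indicator W (x - ?h b) * ?e x = ?e (?h b) * (indicator W (- ?h b + 1 * x) * ?e (- ?h b + 1 * x))" for x
      using expo_add[of "of_int k" "?h b" "x - ?h b"] by simp
    show "integrable lborel (\<lambda>x. indicator W (x - ?h b) * ?e x)"
      unfolding * by (intro integrable_mult_right lborel_integrable_real_affine int) simp
    show "(\<integral>x. indicator W (x - ?h b) * ?e x \<partial>lborel) = ?e (?h b) * (\<integral>x. indicator W x * ?e x \<partial>lborel)"
      unfolding * using lborel_integral_real_affine[of 1 "\<lambda>x. indicator W x * ?e x" "- ?h b"] by simp
  qed
  have U_eq: "indicator U x *\<^sub>R ?e x = (\<Sum>b\<in>B. indicator W (x - ?h b) * ?e x)" for x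
    unfolding sum_distrib_right[symmetric] indicator_U by (simp add: indicator_def)
  have "(\<Sum>b\<in>B. ?e (?h b)) * (\<integral>x. indicator W x * ?e x \<partial>lborel) = (LINT x:U|lborel. ?e x)"
    unfolding set_lebesgue_integral_def U_eq
    by (subst Bochner_Integration.integral_sum) (use int_shift shift in \<open>auto simp: sum_distrib_right\<close>)
  also have "\<dots> = (LINT x:{0..1}|lborel. ?e x)"
  proof (rule integral_U_periodic)
    show "set_integrable lborel {0..1} ?e" by (rule set_integrable_expo) auto
    show "set_integrable lborel U ?e"
      unfolding set_integrable_def U_eq by (intro Bochner_Integration.integrable_sum int_shift)
    show "?e (x + of_int n) = ?e x" for x n
      using expo_eq_1_iff[of "of_int k" "of_int n"] by (simp add: expo_add)
  qed simp
  also have "\<dots> = 0" using k by (rule integral_expo_unit_interval)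
  finally have "(\<Sum>b\<in>B. ?e (?h b)) * (\<integral>x. indicator W x * ?e x \<partial>lborel) = 0" .
  moreover have "?e (?h b) = expo (of_int k / N) (of_int b)" for b by (simp add: expo_eq_cis)
  ultimately have "(\<integral>x. indicator W x * ?e x \<partial>lborel) = 0" using nonzero by simp
  thus ?thesis by (simp add: set_lebesgue_integral_def W_eq)
qed

text \<open>The weight w, the inverse of 1 plus the sum of the squared moduli of the periodizations H l,
  makes the periodic multipliers bounded, so the H l need not be square integrable.\<close>
lemma orthogonal_imp_zero:
  fixes g :: "real \<Rightarrow> complex"
  assumes L: "finite L" "card B * card L = N"
    and L_incong: "\<And>l l'. l \<in> L \<Longrightarrow> l' \<in> L \<Longrightarrow> int N dvd l - l' \<Longrightarrow> l = l'"
    and nonzero: "\<And>l l'. l \<in> L \<Longrightarrow> l' \<in> L \<Longrightarrow> l \<noteq> l' \<Longrightarrow>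
      (\<Sum>b\<in>B. expo (of_int (l - l') / N) (of_int b)) \<noteq> 0"
    and g: "integrable lborel g" and g_W: "\<And>x. x \<notin> W \<Longrightarrow> g x = 0"
    and orth: "\<And>l n. l \<in> L \<Longrightarrow> (\<integral>x. g x * cnj (expo (real N * of_int n + of_int l) x) \<partial>lborel) = 0"
  shows "AE x in lborel. g x = 0"
proof -
  have [measurable]: "g \<in> borel_measurable borel" using g by simp
  have "card L > 0" using L N_pos by (metis mult_is_0 not_gr0)
  let ?h = "\<lambda>j::int. of_int j / real N"
  \<comment> \<open>The periodization of g modulated by -l. Summing over all integers keeps it
    measurable; off W the function g is 0 and fibres of W are finite, so only finitely many terms
    count.\<close>
  define H where "H = (\<lambda>l y. \<Sum>i. g (y + ?h (int_decode i)) * expo (- of_int l) (y + ?h (int_decode i)))"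
  define w where "w = (\<lambda>y. 1 / (1 + (\<Sum>l\<in>L. (norm (H l y))\<^sup>2)))"
  have [measurable]: "H l \<in> borel_measurable borel" for l :: int unfolding H_def by measurable
  have [measurable]: "w \<in> borel_measurable borel" unfolding w_def by measurable
  have S_nonneg: "(\<Sum>l\<in>L. (norm (H l y))\<^sup>2) \<ge> 0" for y by (intro sum_nonneg) simp
  have w_pos: "w y > 0" for y unfolding w_def using S_nonneg[of y] by (simp add: add_pos_nonneg)
  \<comment> \<open>\<open>expo_null_bounded\<close> evaluates multipliers at frac (N x); dividing
    by N returns the representative of x + (1/N)Z in [0, 1/N).\<close>
  define \<phi> where "\<phi> = (\<lambda>l z. cnj (H l (z / N)) * of_real (w (z / N)))"
  have "(\<lambda>z. H l (z / N)) \<in> borel_measurable borel" "(\<lambda>z. w (z / N)) \<in> borel_measurable borel" for l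
    by (rule measurable_compose[of "\<lambda>z. z / real N" borel borel]; simp)+
  hence [measurable]: "\<phi> l \<in> borel_measurable borel" for l :: int
    unfolding \<phi>_def
    by (intro borel_measurable_times cnj_measurable measurable_compose[OF _ borel_measurable_of_real])
  have \<phi>_bd: "norm (\<phi> l z) \<le> 1" if "l \<in> L" for l z
  proof -
    define y where "y = z / real N"
    \<comment> \<open>For t = \<open>norm (H l y)\<close> the right-hand side is 2 * (1 + t^2 -
      t).\<close>
    have "0 \<le> (norm (H l y) - 1)\<^sup>2 + (norm (H l y))\<^sup>2 + 1" by simp
    hence "norm (H l y) \<le> 1 + (norm (H l y))\<^sup>2" by (simp add: power2_eq_square algebra_simps)
    also have "(norm (H l y))\<^sup>2 \<le> (\<Sum>l\<in>L. (norm (H l y))\<^sup>2)"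
      using that L(1) by (intro member_le_sum) auto
    finally show ?thesis
      using S_nonneg[of y] unfolding \<phi>_def y_def[symmetric] norm_mult norm_of_real w_def
      by (simp add: divide_simps)
  qed
  define F where "F = (\<lambda>l x. g x * expo (- of_int l) x * \<phi> l (frac (real N * x)))"
  have null: "expo_null (real N) (\<lambda>x. g x * expo (- of_int l) x)" if "l \<in> L" for l
    unfolding expo_null_def
  proof (intro conjI allI)
    show "integrable lborel (\<lambda>x. g x * expo (- of_int l) x)"
      by (rule integrable_mult_bounded[OF g, where C = 1]) auto
    fix n :: int
    have *: "g x * expo (- of_int l) x * expo (of_int n * real N) x
        = g x * cnj (expo (real N * of_int (- n) + of_int l) x)" for x
      by (simp add: expo_eq_cis cis_mult cis_cnj algebra_simps)
    show "(\<integral>x. g x * expo (- of_int l) x * expo (of_int n * real N) x \<partial>lborel) = 0"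
      unfolding * by (rule orth[OF that])
  qed
  have F0: "(\<integral>x. F l x \<partial>lborel) = 0" if "l \<in> L" for l
    unfolding F_def by (rule expo_null_bounded[OF null[OF that], where C = 1]) (auto simp: \<phi>_bd that)
  have F_int: "integrable lborel (F l)" if "l \<in> L" for l
    unfolding F_def
  proof (rule integrable_mult_bounded)
    show "integrable lborel (\<lambda>x. g x * expo (- of_int l) x)"
      using null[OF that] by (simp add: expo_null_def)
  qed (use \<phi>_bd[OF that] in auto)
  \<comment> \<open>On a fibre, the values of g are recovered from the coefficients
    \<open>H l y\<close> by orthogonality over L; only the term j = a survives.\<close>
  have inversion: "(\<Sum>l\<in>L. H l y * expo (of_int l) (y + ?h a)) = of_nat (card L) * g (y + ?h a)"
    if W: "y + ?h a \<in> W" for y a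
  proof -
    have "y \<notin> Z" using W W_Z Z_shift[of y a] by blast
    define A where "A = {j. y + ?h j \<in> W}"
    have tile: "int_tiling N A B" unfolding A_def by (rule tiling[OF \<open>y \<notin> Z\<close>])
    have fin: "finite A" by (rule int_tiling_card[OF tile N_pos])
    have "a \<in> A" using W by (simp add: A_def)
    have H: "H l y = (\<Sum>j\<in>A. g (y + ?h j) * expo (- of_int l) (y + ?h j))" for l
    proof -
      have "H l y = (\<Sum>i\<in>int_encode ` A. g (y + ?h (int_decode i)) * expo (- of_int l) (y + ?h (int_decode i)))"
        unfolding H_def
      proof (rule suminf_finite)
        fix i assume "i \<notin> int_encode ` A"
        hence "int_decode i \<notin> A" by (metis image_eqI int_decode_inverse)
        thus "g (y + ?h (int_decode i)) * expo (- of_int l) (y + ?h (int_decode i)) = 0"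
          by (simp add: A_def g_W)
      qed (use fin in simp)
      also have "\<dots> = (\<Sum>j\<in>A. g (y + ?h j) * expo (- of_int l) (y + ?h j))"
        by (subst sum.reindex) (auto intro: inj_on_subset[OF inj_int_encode])
      finally show ?thesis .
    qed
    have e: "expo (- of_int l) (y + ?h j) * expo (of_int l) (y + ?h a) = expo (of_int l) (of_int (a - j) / N)"
      for l j by (simp add: expo_eq_cis cis_mult diff_divide_distrib algebra_simps)
    have "(\<Sum>l\<in>L. H l y * expo (of_int l) (y + ?h a)) =
        (\<Sum>l\<in>L. \<Sum>j\<in>A. g (y + ?h j) * expo (of_int l) (of_int (a - j) / N))"
      by (simp add: H sum_distrib_right mult.assoc e)
    also have "\<dots> = (\<Sum>j\<in>A. g (y + ?h j) * (\<Sum>l\<in>L. expo (of_int l) (of_int (a - j) / N)))"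
      by (subst sum.swap) (simp add: sum_distrib_left)
    also have "\<dots> = (\<Sum>j\<in>A. g (y + ?h j) * (if a = j then of_nat (card L) else 0))"
      using int_tiling_dual_orthogonal[OF tile N_pos L L_incong nonzero \<open>a \<in> A\<close>] by simp
    also have "\<dots> = (\<Sum>j\<in>A. if a = j then g (y + ?h j) * of_nat (card L) else 0)"
      by (rule sum.cong) auto
    also have "\<dots> = of_nat (card L) * g (y + ?h a)"
      using fin \<open>a \<in> A\<close> by (simp add: mult.commute)
    finally show ?thesis .
  qed
  \<comment> \<open>Summed over L, the conjugated coefficients in F reassemble the conjugate of g by
    the inversion formula, so the vanishing integrals of the F l add up to that of a nonnegative
    G.\<close>
  define G where "G = (\<lambda>x. real (card L) * w (frac (real N * x) / N) * (norm (g x))\<^sup>2)"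
  have F_sum: "(\<Sum>l\<in>L. F l x) = of_real (G x)" for x
  proof (cases "x \<in> W")
    case True
    define y where "y = frac (real N * x) / N"
    define a where "a = \<lfloor>real N * x\<rfloor>"
    have x: "x = y + ?h a" using N_pos by (simp add: y_def a_def frac_def field_simps)
    have "(\<Sum>l\<in>L. F l x) = g x * of_real (w y) * cnj (\<Sum>l\<in>L. H l y * expo (of_int l) x)"
      by (simp add: F_def \<phi>_def y_def sum_distrib_left cnj_expo mult_ac)
    also have "(\<Sum>l\<in>L. H l y * expo (of_int l) x) = of_nat (card L) * g x"
      by (rule inversion[of y a, folded x, OF True])
    also have "g x * of_real (w y) * cnj (of_nat (card L) * g x) =
        of_nat (card L) * of_real (w y) * (g x * cnj (g x))" by simp
    also have "\<dots> = of_real (G x)"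
      unfolding complex_norm_square[symmetric] by (simp add: G_def y_def)
    finally show ?thesis .
  qed (simp add: F_def G_def g_W)
  have "integrable lborel (\<lambda>x. complex_of_real (G x))"
    unfolding F_sum[symmetric] by (intro Bochner_Integration.integrable_sum F_int)
  hence G_int: "integrable lborel G" by (simp add: complex_of_real_integrable_eq)
  have "complex_of_real (\<integral>x. G x \<partial>lborel) = (\<Sum>l\<in>L. \<integral>x. F l x \<partial>lborel)"
    unfolding integral_complex_of_real[symmetric] F_sum[symmetric]
    by (rule Bochner_Integration.integral_sum) (rule F_int)
  hence "(\<integral>x. G x \<partial>lborel) = 0" by (simp add: F0)
  moreover have "G x \<ge> 0" for x using w_pos[of "frac (real N * x) / N"] by (simp add: G_def)
  ultimately have "AE x in lborel. G x = 0"
    using integral_nonneg_eq_0_iff_AE[OF G_int] by simp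
  thus ?thesis
  proof eventually_elim
    case (elim x)
    moreover have "real (card L) \<noteq> 0" "w (frac (real N * x) / N) \<noteq> 0"
      using \<open>card L > 0\<close> w_pos[of "frac (real N * x) / N"] by linarith+
    ultimately have "(norm (g x))\<^sup>2 = 0" unfolding G_def mult_eq_0_iff by blast
    thus ?case by simp
  qed
qed

end

section \<open>From measurable tiles to Borel tiles with exact fibres\<close>

lemma tiles_with_imp_fibre_tiling:
  assumes N: "N > 0" and B: "\<And>b b'. b \<in> B \<Longrightarrow> b' \<in> B \<Longrightarrow> int N dvd b - b' \<Longrightarrow> b = b'"
    and tiles: "tiles_with \<Omega> {of_int n + of_int b / real N | n b. b \<in> B}"
  obtains W Z where "fibre_tiling N B W Z" "\<And>x. x \<notin> Z \<Longrightarrow> x \<in> W \<longleftrightarrow> x \<in> \<Omega>"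
proof -
  let ?h = "\<lambda>j::int. of_int j / real N"
  define T where "T = {of_int n + of_int b / real N | n b. b \<in> B}"
  have T: "T = (\<lambda>(n, b). of_int n + ?h b) ` (UNIV \<times> B)" by (auto simp: T_def)
  have "countable T" unfolding T by (intro countable_image) auto
  have "tiles_with \<Omega> T" unfolding T_def by (fact tiles)
  hence \<Omega>: "\<Omega> \<in> sets lebesgue" "emeasure lebesgue \<Omega> < \<infinity>"
    and cover: "(\<Union>t\<in>T. (\<lambda>x. x + t) ` \<Omega>) = UNIV"
    by (simp_all only: tiles_with_def)
  have null: "\<forall>t\<in>T. \<forall>t'\<in>T. t \<noteq> t' \<longrightarrow>
      ((\<lambda>x. x + t) ` \<Omega> \<inter> (\<lambda>x. x + t') ` \<Omega>) \<in> null_sets lebesgue"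
    using \<open>tiles_with \<Omega> T\<close> unfolding tiles_with_def by (elim conjE)
  \<comment> \<open>All overlaps of distinct translates; T is countable, so together they are still
    null.\<close>
  define M where "M = (\<Union>p\<in>{p \<in> T \<times> T. fst p \<noteq> snd p}. (\<lambda>x. x + fst p) ` \<Omega> \<inter> (\<lambda>x. x + snd p) ` \<Omega>)"
  have "M \<in> null_sets lebesgue" unfolding M_def
  proof (rule null_sets_UN')
    show "countable {p \<in> T \<times> T. fst p \<noteq> snd p}"
      by (rule countable_subset[of _ "T \<times> T"]) (use \<open>countable T\<close> in auto)
    fix p assume "p \<in> {p \<in> T \<times> T. fst p \<noteq> snd p}"
    thus "(\<lambda>x. x + fst p) ` \<Omega> \<inter> (\<lambda>x. x + snd p) ` \<Omega> \<in> null_sets lebesgue"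
      by (intro null[rule_format]) (simp_all add: mem_Times_iff)
  qed
  then obtain M' where M': "M' \<in> null_sets lborel" "M \<subseteq> M'"
    unfolding null_sets_completion_iff2 by blast
  obtain S P P' where S: "\<Omega> = S \<union> P" "P \<subseteq> P'" "P' \<in> null_sets lborel" "S \<in> sets lborel"
    using \<Omega>(1) by (rule sets_completionE)
  \<comment> \<open>The exceptional points: those in an overlap, and those where \<Omega> may differ
    from its Borel part S.\<close>
  define Z0 where "Z0 = M' \<union> P'"
  have Z0: "Z0 \<in> null_sets lborel" unfolding Z0_def using M' S by auto
  \<comment> \<open>Saturating under (1/N)Z takes countably many translates. Removing the result
    from S leaves the fibres over points outside Z intact.\<close>
  define Z where "Z = (\<Union>j. {x. x - ?h j \<in> Z0})"
  have Z: "Z \<in> null_sets lborel" unfolding Z_def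
    by (intro null_sets_UN null_sets_translation Z0)
  have Z_shift: "x + ?h j \<in> Z \<longleftrightarrow> x \<in> Z" for x j
  proof -
    have "x + ?h j \<in> Z \<longleftrightarrow> (\<exists>i. x - ?h (i - j) \<in> Z0)"
      by (simp add: Z_def diff_divide_distrib algebra_simps)
    also have "\<dots> \<longleftrightarrow> (\<exists>i. x - ?h i \<in> Z0)" by (metis add_diff_cancel_right')
    finally show ?thesis by (simp add: Z_def)
  qed
  have Z0_Z: "Z0 \<subseteq> Z" by (auto simp: Z_def intro!: exI[of _ 0])
  define W where "W = S - Z"
  have W_\<Omega>: "x \<in> W \<longleftrightarrow> x \<in> \<Omega>" if "x \<notin> Z" for x
    using that S Z0_Z by (auto simp: W_def Z0_def)
  have "fibre_tiling N B W Z"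
  proof
    show W_borel: "W \<in> sets borel" unfolding W_def using S Z by auto
    have "W \<subseteq> \<Omega>" using S by (auto simp: W_def)
    hence "emeasure lebesgue W \<le> emeasure lebesgue \<Omega>" using \<Omega> by (intro emeasure_mono)
    moreover have "emeasure lebesgue W = emeasure lborel W" using W_borel by simp
    ultimately show "emeasure lborel W < \<infinity>" using \<Omega> by simp
    fix x assume x: "x \<notin> Z"
    define A where "A = {j. x + ?h j \<in> W}"
    have A: "j \<in> A \<longleftrightarrow> x + ?h j \<in> \<Omega>" for j unfolding A_def using W_\<Omega> x Z_shift by simp
    have "int_tiling N A B" unfolding int_tiling_def
    proof (intro conjI allI ballI impI)
      fix n
      obtain t \<omega> where "t \<in> T" "\<omega> \<in> \<Omega>" "x + ?h n = \<omega> + t" using cover by blast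
      then obtain m b where b: "b \<in> B" "x + ?h n = \<omega> + (of_int m + ?h b)" by (auto simp: T_def)
      hence "\<omega> = x + ?h (n - int N * m - b)" using N by (simp add: field_simps)
      hence "n - int N * m - b \<in> A" using A \<open>\<omega> \<in> \<Omega>\<close> by simp
      with b(1) show "\<exists>a\<in>A. \<exists>b\<in>B. int N dvd n - (a + b)"
        by (intro bexI[of _ "n - int N * m - b"] bexI[of _ b]) auto
    next
      fix a b a' b' assume *: "a \<in> A" "b \<in> B" "a' \<in> A" "b' \<in> B" "int N dvd (a + b) - (a' + b')"
      then obtain m where m: "(a + b) - (a' + b') = int N * m" by blast
      \<comment> \<open>Two elements of T that send the points x + a/N and x + a'/N of \<Omega> to
        the same place. If they differed, that place would lie in M, although it belongs to the
        coset of x, which avoids Z.\<close>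
      define t where "t = of_int 0 + ?h b"
      define t' where "t' = of_int m + ?h b'"
      have T2: "t \<in> T" "t' \<in> T" unfolding t_def t'_def T_def using * by blast+
      have "a + b = a' + b' + int N * m" using m by simp
      hence "?h (a + b) = ?h (a' + b' + int N * m)" by (simp only:)
      hence eq: "x + ?h a + t = x + ?h a' + t'" using N by (simp add: t_def t'_def add_divide_distrib)
      have "t = t'"
      proof (rule ccontr)
        assume "t \<noteq> t'"
        moreover have "x + ?h a \<in> \<Omega>" "x + ?h a' \<in> \<Omega>" using * A by auto
        hence "x + ?h a + t \<in> (\<lambda>x. x + t) ` \<Omega>" "x + ?h a + t \<in> (\<lambda>x. x + t') ` \<Omega>"
          unfolding eq by (metis eq imageI)+
        ultimately have "x + ?h a + t \<in> M" using T2 unfolding M_def by (intro UN_I[of "(t, t')"]) auto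
        hence "x + ?h a + t \<in> Z" using M' Z0_Z by (auto simp: Z0_def)
        hence "x + ?h (a + b) \<in> Z" by (simp add: t_def add_divide_distrib add.assoc)
        thus False using Z_shift[of x "a + b"] x by blast
      qed
      \<comment> \<open>Equal translations still have to come from the same b, which is where
        incongruence of B modulo N enters.\<close>
      hence "real_of_int b = real_of_int (int N * m + b')" using N by (simp add: t_def t'_def field_simps)
      hence "b - b' = int N * m" by (simp only: of_int_eq_iff)
      hence "b = b'" using B[OF *(2,4)] by simp
      moreover have "x + ?h a = x + ?h a'" using eq \<open>t = t'\<close> by simp
      hence "a = a'" using N by simp
      ultimately show "a = a'" "b = b'" by simp_all
    qed
    thus "int_tiling N {j. x + ?h j \<in> W} B" by (simp add: A_def)
  qed (use N Z Z_shift in \<open>auto simp: W_def\<close>)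
  thus ?thesis using that W_\<Omega> by blast
qed

lemma complex_borel_representative:
  fixes f :: "real \<Rightarrow> complex"
  assumes "f \<in> borel_measurable lebesgue"
  obtains g where "g \<in> borel_measurable borel" "AE x in lebesgue. f x = g x"
proof -
  have "(\<lambda>x. Re (f x)) \<in> borel_measurable lebesgue" "(\<lambda>x. Im (f x)) \<in> borel_measurable lebesgue"
    using assms by auto
  from this[THEN completion_ex_borel_measurable_real] obtain u v
    where uv: "u \<in> borel_measurable lborel" "AE x in lborel. Re (f x) = u x"
      "v \<in> borel_measurable lborel" "AE x in lborel. Im (f x) = v x"
    by blast
  have [measurable]: "u \<in> borel_measurable borel" "v \<in> borel_measurable borel" using uv by auto
  show ?thesis
  proof
    show "(\<lambda>x. Complex (u x) (v x)) \<in> borel_measurable borel"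
      unfolding Complex_eq by measurable
    show "AE x in lebesgue. f x = Complex (u x) (v x)"
      using uv(2,4)[THEN AE_completion] by eventually_elim (simp add: complex_eq_iff)
  qed
qed

theorem universal_spectrum_of_nonvanishing:
  assumes N: "N > 0" and B_incong: "\<And>b b'. b \<in> B \<Longrightarrow> b' \<in> B \<Longrightarrow> int N dvd b - b' \<Longrightarrow> b = b'"
    and L: "finite L" "card B * card L = N"
    and L_incong: "\<And>l l'. l \<in> L \<Longrightarrow> l' \<in> L \<Longrightarrow> int N dvd l - l' \<Longrightarrow> l = l'"
    and nonzero: "\<And>l l'. l \<in> L \<Longrightarrow> l' \<in> L \<Longrightarrow> l \<noteq> l' \<Longrightarrow>
      (\<Sum>b\<in>B. expo (of_int (l - l') / N) (of_int b)) \<noteq> 0"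
  shows "universal_spectrum {real N * of_int n + of_int l | n l. l \<in> L}
    {of_int n + of_int b / real N | n b. b \<in> B}"
  unfolding universal_spectrum_def
proof (intro allI impI)
  fix \<Omega> assume tiles: "tiles_with \<Omega> {of_int n + of_int b / real N | n b. b \<in> B}"
  define \<Lambda> where "\<Lambda> = {real N * of_int n + of_int l | n l. l \<in> L}"
  obtain W Z where WZ: "fibre_tiling N B W Z" "\<And>x. x \<notin> Z \<Longrightarrow> x \<in> W \<longleftrightarrow> x \<in> \<Omega>"
    using tiles_with_imp_fibre_tiling[OF N B_incong tiles] by blast
  interpret fibre_tiling N B W Z by (fact WZ(1))
  have \<Omega>: "\<Omega> \<in> sets lebesgue" "emeasure lebesgue \<Omega> < \<infinity>"
    using tiles by (simp_all only: tiles_with_def)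
  have AE_Z: "AE x in lebesgue. x \<notin> Z" using AE_completion[OF AE_not_in[OF Z_null]] .
  have expo_leb: "expo l \<in> borel_measurable lebesgue" for l
    by (intro measurable_completion) simp
  have discrete: "discrete_set \<Lambda>"
    unfolding discrete_set_def
  proof
    fix x assume x: "x \<in> \<Lambda>"
    have int: "y \<in> \<int>" if "y \<in> \<Lambda>" for y using that by (auto simp: \<Lambda>_def)
    have "ball x 1 \<inter> \<Lambda> = {x}"
    proof (intro set_eqI iffI)
      fix y assume y: "y \<in> ball x 1 \<inter> \<Lambda>"
      hence "\<bar>x - y\<bar> < 1" by (simp add: dist_real_def)
      moreover have "x - y \<in> \<int>" using x y by (intro Ints_diff int) auto
      ultimately have "x - y = 0" using Ints_nonzero_abs_less1[of "x - y"] by blast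
      thus "y \<in> {x}" by simp
    qed (use x in auto)
    thus "x isolated_in \<Lambda>" using x unfolding isolated_in_def by (intro conjI exI[of _ "ball x 1"]) auto
  qed
  have orthogonal: "L2_inner \<Omega> (expo p) (expo q) = 0" if "p \<in> \<Lambda>" "q \<in> \<Lambda>" "p \<noteq> q" for p q
  proof -
    from that obtain n l n' l' where *: "p = real N * of_int n + of_int l" "l \<in> L"
      "q = real N * of_int n' + of_int l'" "l' \<in> L" unfolding \<Lambda>_def by blast
    define k where "k = int N * (n - n') + (l - l')"
    have k: "of_int k = p - q" by (simp add: k_def * algebra_simps)
    have e: "expo p x * cnj (expo q x) = expo (of_int k) x" for x
      unfolding k by (simp add: expo_eq_cis cis_mult cis_cnj algebra_simps)
    \<comment> \<open>Frequencies matter to the sum over B only modulo N, so k may be replaced by l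
      - l'.\<close>
    have "expo (of_int k / N) (of_int b) = expo (of_int (l - l') / N) (of_int b)" for b
    proof -
      have "of_int k / real N * of_int b = of_int ((n - n') * b) + of_int (l - l') / real N * of_int b"
        using N by (simp add: k_def field_simps)
      hence "expo (of_int k / N) (of_int b) = expo 1 (of_int ((n - n') * b)) * expo (of_int (l - l') / N) (of_int b)"
        by (simp only: expo_eq_cis cis_mult distrib_left mult_1_left)
      moreover have "expo 1 (of_int ((n - n') * b)) = 1" by (simp add: expo_eq_1_iff del: of_int_mult)
      ultimately show ?thesis by simp
    qed
    moreover have "(\<Sum>b\<in>B. expo (of_int (l - l') / N) (of_int b)) \<noteq> 0"
    \<comment> \<open>For distinct frequencies in the same class modulo N the sum over B is its
      cardinality.\<close>
    proof (cases "l = l'")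
      case True
      have "card B \<noteq> 0" using L(2) N by (metis mult_is_0 not_gr0)
      thus ?thesis using True by simp
    qed (use nonzero * in blast)
    ultimately have "(\<Sum>b\<in>B. expo (of_int k / N) (of_int b)) \<noteq> 0" by simp
    moreover have "k \<noteq> 0" using k that(3) by auto
    ultimately have W0: "(LINT x:W|lborel. expo (of_int k) x) = 0" by (intro integral_W_expo)
    have "L2_inner \<Omega> (expo p) (expo q) = (\<integral>x. indicator \<Omega> x *\<^sub>R expo (of_int k) x \<partial>lebesgue)"
      by (simp add: L2_inner_def set_lebesgue_integral_def e)
    also have "\<dots> = (\<integral>x. indicator W x *\<^sub>R expo (of_int k) x \<partial>lebesgue)"
    proof (rule integral_cong_AE)
      show "AE x in lebesgue. indicator \<Omega> x *\<^sub>R expo (of_int k) x = indicator W x *\<^sub>R expo (of_int k) x"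
        using AE_Z by eventually_elim (simp add: indicator_def WZ(2))
      show "(\<lambda>x. indicator \<Omega> x *\<^sub>R expo (of_int k) x) \<in> borel_measurable lebesgue"
        using \<Omega>(1) expo_leb by (intro borel_measurable_scaleR borel_measurable_indicator)
      show "(\<lambda>x. indicator W x *\<^sub>R expo (of_int k) x) \<in> borel_measurable lebesgue"
        by (intro measurable_completion) simp
    qed
    also have "\<dots> = (\<integral>x. indicator W x *\<^sub>R expo (of_int k) x \<partial>lborel)"
      by (rule integral_completion) measurable
    finally show ?thesis using W0 by (simp add: set_lebesgue_integral_def)
  qed
  have complete: "AE x in lebesgue. x \<in> \<Omega> \<longrightarrow> f x = 0"
    if f: "in_L2 \<Omega> f" and f_orth: "\<forall>p\<in>\<Lambda>. L2_inner \<Omega> f (expo p) = 0" for f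
  proof -
    define f0 where "f0 = (\<lambda>x. indicator \<Omega> x *\<^sub>R f x)"
    have f0: "f0 \<in> borel_measurable lebesgue"
      using f by (simp add: in_L2_def set_borel_measurable_def f0_def)
    \<comment> \<open>On a set of finite measure L^2 lies in L^1, by t <= 1 + t^2.\<close>
    have f0_int: "integrable lebesgue f0"
    proof (rule Bochner_Integration.integrable_bound[OF _ f0])
      show "integrable lebesgue (\<lambda>x. indicator \<Omega> x + indicator \<Omega> x *\<^sub>R (norm (f x))\<^sup>2)"
        using f \<Omega> by (intro Bochner_Integration.integrable_add)
          (auto simp: in_L2_def set_integrable_def integrable_indicator_iff)
      have "1 + t\<^sup>2 - t = (t - 1 / 2)\<^sup>2 + 3 / 4" for t :: real
        by (simp add: power2_eq_square field_simps)
      hence "t \<le> 1 + t\<^sup>2" for t :: real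
        using zero_le_power2[of "t - 1 / 2"] by (smt (verit) divide_nonneg_nonneg)
      thus "AE x in lebesgue. norm (f0 x) \<le> norm (indicator \<Omega> x + indicator \<Omega> x *\<^sub>R (norm (f x))\<^sup>2)"
        by (auto simp: f0_def indicator_def abs_of_nonneg add_nonneg_nonneg)
    qed
    obtain g0 where [measurable]: "g0 \<in> borel_measurable borel" and g0: "AE x in lebesgue. f0 x = g0 x"
      using complex_borel_representative[OF f0] by blast
    define g where "g = (\<lambda>x. indicator W x *\<^sub>R g0 x)"
    have g_borel [measurable]: "g \<in> borel_measurable borel" unfolding g_def by measurable
    have f0_g: "AE x in lebesgue. f0 x = g x"
      using g0 AE_Z
    proof eventually_elim
      case (elim x)
      thus ?case using WZ(2)[of x] by (cases "x \<in> \<Omega>") (simp_all add: f0_def g_def)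
    qed
    have "g \<in> borel_measurable lebesgue" by (intro measurable_completion) simp
    from integrable_cong_AE[OF f0 this f0_g] f0_int have "integrable lebesgue g" by blast
    hence g_int: "integrable lborel g" by (subst (asm) integrable_completion) simp_all
    have "(\<integral>x. g x * cnj (expo (real N * of_int n + of_int l) x) \<partial>lborel) = 0" if "l \<in> L" for l n
    proof -
      let ?e = "expo (real N * of_int n + of_int l)"
      have "(\<integral>x. g x * cnj (?e x) \<partial>lborel) = (\<integral>x. g x * cnj (?e x) \<partial>lebesgue)"
        by (rule integral_completion[symmetric]) measurable
      also have "\<dots> = (\<integral>x. f0 x * cnj (?e x) \<partial>lebesgue)"
      proof (rule integral_cong_AE)
        show "AE x in lebesgue. g x * cnj (?e x) = f0 x * cnj (?e x)"
          using f0_g by eventually_elim simp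
        show "(\<lambda>x. g x * cnj (?e x)) \<in> borel_measurable lebesgue"
          by (intro measurable_completion) simp
        show "(\<lambda>x. f0 x * cnj (?e x)) \<in> borel_measurable lebesgue"
          by (rule borel_measurable_times[OF f0]) (intro measurable_completion, simp)
      qed
      also have "\<dots> = L2_inner \<Omega> f ?e"
        by (simp add: L2_inner_def set_lebesgue_integral_def f0_def)
      also have "\<dots> = 0" using f_orth that unfolding \<Lambda>_def by blast
      finally show ?thesis .
    qed
    hence "AE x in lborel. g x = 0"
      by (intro orthogonal_imp_zero[OF L L_incong nonzero g_int]) (auto simp: g_def)
    hence "AE x in lebesgue. g x = 0" by (rule AE_completion)
    with f0_g show ?thesis by eventually_elim (auto simp: f0_def)
  qed
  have "spectral_with \<Omega> \<Lambda>"
    unfolding spectral_with_def using discrete orthogonal complete by blast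
  thus "spectral_with \<Omega> {real N * of_int n + of_int l | n l. l \<in> L}" by (simp only: \<Lambda>_def)
qed

section \<open>The exponential sum of B\<close>

lemma root_sum_zero:
  fixes z :: complex
  shows "z ^ 2 = 1 \<Longrightarrow> z \<noteq> 1 \<Longrightarrow> 1 + z = 0"
    and "z ^ 3 = 1 \<Longrightarrow> z \<noteq> 1 \<Longrightarrow> 1 + z + z ^ 2 = 0"
    and "z ^ 5 = 1 \<Longrightarrow> z \<noteq> 1 \<Longrightarrow> 1 + z + z ^ 2 + z ^ 3 + z ^ 4 = 0"
proof -
  assume "z ^ 2 = 1" "z \<noteq> 1"
  then have "(z - 1) * (1 + z) = 0" "z - 1 \<noteq> 0"
    by (simp_all add: algebra_simps power2_eq_square)
  thus "1 + z = 0" by simp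
next
  assume "z ^ 3 = 1" "z \<noteq> 1"
  then have "(z - 1) * (1 + z + z ^ 2) = 0" "z - 1 \<noteq> 0"
    by (simp_all add: algebra_simps eval_nat_numeral)
  thus "1 + z + z ^ 2 = 0" by simp
next
  assume "z ^ 5 = 1" "z \<noteq> 1"
  then have "(z - 1) * (1 + z + z ^ 2 + z ^ 3 + z ^ 4) = 0" "z - 1 \<noteq> 0"
    by (simp_all add: algebra_simps eval_nat_numeral)
  thus "1 + z + z ^ 2 + z ^ 3 + z ^ 4 = 0" by simp
qed

text \<open>The 20 multiples of 30 in B contribute a polynomial in the 30th root of unity
  u = exp(2 pi i k/30) to the sum at frequency k. The other ten elements form the progressions
  126 + 180 {0,...,4}, 220 + 300 {0,1,2} and 375 + 450 {0,1}, whose sums vanish unless 5, 3, 2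
  divides k, respectively.\<close>
definition B_poly :: "complex \<Rightarrow> complex" where
  "B_poly u = 1 + u + u^2 + u^6 + u^7 + u^8 + u^10 + u^11 + u^12 + u^13 + u^16 + u^17 + u^18
     + u^19 + u^22 + u^23 + u^25 + u^26 + u^28 + u^29"

section \<open>Values of \<open>B_poly\<close> at roots of unity of orders 2, 3, 5, 6, 10 and
  15\<close>

lemma B_poly_order2: "u = - 1 \<Longrightarrow> B_poly u = 2"
  by (simp add: B_poly_def)

text \<open>Exponents are reduced modulo 3, then the cyclotomic relation removes one power. Orders
  5, 6 and 10 follow the same pattern, with alternating signs where u^3 or u^5 is -1.\<close>

lemma B_poly_order3: assumes "u ^ 3 = 1" "u \<noteq> 1" shows "B_poly u = 2 * u - 3"
proof -
  have *: "u^2 = - 1 - u" using root_sum_zero(2)[OF assms] by (simp add: algebra_simps eq_neg_iff_add_eq_0)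
  have r: "u^(3 + k) = u^k" for k using assms(1) by (simp add: power_add)
  show ?thesis unfolding B_poly_def
    using r[of 3] r[of 4] r[of 5] r[of 7] r[of 8] r[of 9] r[of 10] r[of 13] r[of 14] r[of 15]
     r[of 16] r[of 19] r[of 20] r[of 22] r[of 23] r[of 25] r[of 26] r[of 0] r[of 1] r[of 2]
     r[of 6] r[of 11] r[of 12] r[of 17] r[of 18] r[of 21] r[of 24]
    by (simp add: *)
qed

lemma B_poly_order5: assumes "u ^ 5 = 1" "u \<noteq> 1" shows "B_poly u = - 2 - 3 * u^4"
proof -
  have *: "u^3 = - 1 - u - u^2 - u^4" using root_sum_zero(3)[OF assms]
    by (simp add: algebra_simps eq_neg_iff_add_eq_0)
  have r: "u^(5 + k) = u^k" for k using assms(1) by (simp add: power_add)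
  show ?thesis unfolding B_poly_def
    using r[of 3] r[of 4] r[of 5] r[of 7] r[of 8] r[of 9] r[of 10] r[of 13] r[of 14] r[of 15]
     r[of 16] r[of 19] r[of 20] r[of 22] r[of 23] r[of 25] r[of 26] r[of 0] r[of 1] r[of 2]
     r[of 6] r[of 11] r[of 12] r[of 17] r[of 18] r[of 21] r[of 24]
    by (simp add: *)
qed

lemma B_poly_order6: assumes "u ^ 3 = - 1" "u \<noteq> - 1" shows "B_poly u = 5"
proof -
  have "(u + 1) * (u^2 - u + 1) = 0" "u + 1 \<noteq> 0"
    using assms by (simp_all add: algebra_simps eval_nat_numeral add_eq_0_iff)
  hence "u^2 - u + 1 = 0" by simp
  hence *: "u^2 = u - 1" by algebra
  have r: "u^(3 + k) = - (u^k)" for k using assms(1) by (simp add: power_add)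
  show ?thesis unfolding B_poly_def
    using r[of 3] r[of 4] r[of 5] r[of 7] r[of 8] r[of 9] r[of 10] r[of 13] r[of 14] r[of 15]
     r[of 16] r[of 19] r[of 20] r[of 22] r[of 23] r[of 25] r[of 26] r[of 0] r[of 1] r[of 2]
     r[of 6] r[of 11] r[of 12] r[of 17] r[of 18] r[of 21] r[of 24]
    by (simp add: *)
qed

lemma B_poly_order10: assumes "u ^ 5 = - 1" "u \<noteq> - 1" shows "B_poly u = - 3 * u^4"
proof -
  have "(u + 1) * (u^4 - u^3 + u^2 - u + 1) = 0" "u + 1 \<noteq> 0"
    using assms by (simp_all add: algebra_simps eval_nat_numeral add_eq_0_iff)
  hence "u^4 - u^3 + u^2 - u + 1 = 0" by simp
  hence *: "u^3 = u^4 + u^2 - u + 1" by (simp add: algebra_simps)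
  have r: "u^(5 + k) = - (u^k)" for k using assms(1) by (simp add: power_add)
  show ?thesis unfolding B_poly_def
    using r[of 3] r[of 4] r[of 5] r[of 7] r[of 8] r[of 9] r[of 10] r[of 13] r[of 14] r[of 15]
     r[of 16] r[of 19] r[of 20] r[of 22] r[of 23] r[of 25] r[of 26] r[of 0] r[of 1] r[of 2]
     r[of 6] r[of 11] r[of 12] r[of 17] r[of 18] r[of 21] r[of 24]
    by (simp add: *)
qed

lemma B_poly_order15: assumes "u ^ 15 = 1" "u ^ 5 \<noteq> 1" "u ^ 3 \<noteq> 1" shows "B_poly u = - 2 * u^5"
proof -
  have "(u - 1) * (u^2 + u + 1) = u ^ 3 - 1" by (simp add: algebra_simps eval_nat_numeral)
  with assms(3) have 1: "u^2 + u + 1 \<noteq> 0" by auto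
  \<comment> \<open>The last factor is the 15th cyclotomic polynomial; the other two contain the
    roots of order dividing 5 or equal to 3.\<close>
  have "(u^5 - 1) * (u^2 + u + 1) * (u^8 - u^7 + u^5 - u^4 + u^3 - u + 1) = u ^ 15 - 1"
    by (simp add: algebra_simps eval_nat_numeral)
  with assms 1 have "u^8 - u^7 + u^5 - u^4 + u^3 - u + 1 = 0" by auto
  hence *: "u^8 = u^7 - u^5 + u^4 - u^3 + u - 1" by algebra
  have r: "u^(15 + k) = u^k" for k using assms(1) by (simp add: power_add)
  have "u^9 = u * u^8" by (simp add: eval_nat_numeral)
  hence 9: "u^9 = u^7 - u^6 - u^3 + u^2 - 1" using * by algebra
  have "1 + u^5 + (u^5)^2 = 0"
    using assms root_sum_zero(2)[of "u^5"] by (simp flip: power_mult)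
  hence 10: "u^10 = - 1 - u^5" by algebra
  have 11: "u^11 = - u - u^6" using 10 by algebra
  have 12: "u^12 = - (u^2) - u^7" using 10 by algebra
  have 13: "u^13 = - (u^3) - u^8" using 10 by algebra
  have 14: "u^14 = - (u^4) - u^9" using 10 by algebra
  have "B_poly u = 1 + u + u^2 + u^6 + u^7 + u^8 + u^10 + u^11 + u^12 + u^13 + u^1 + u^2 + u^3
     + u^4 + u^7 + u^8 + u^10 + u^11 + u^13 + u^14"
    unfolding B_poly_def using r[of 1] r[of 2] r[of 3] r[of 4] r[of 7] r[of 8] r[of 10] r[of 11] r[of 13] r[of 14]
    by simp
  also have "\<dots> = - 2 * u^5" unfolding 10 11 12 13 14 9 * by (simp add: algebra_simps)
  finally show ?thesis .
qed

text \<open>The steps 180, 300 and 450 of the three progressions are multiples of 30, so their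
  ratios are the powers u^6, u^10 and u^15.\<close>

lemma sum_B_set:
  fixes e :: "int \<Rightarrow> complex"
  assumes add: "\<And>i j. e (i + j) = e i * e j" and e0: "e 0 = 1"
  defines "u \<equiv> e 30"
  shows "(\<Sum>b\<in>B_set. e b) = B_poly u + e 126 * (1 + u^6 + (u^6)^2 + (u^6)^3 + (u^6)^4)
    + e 220 * (1 + u^10 + (u^10)^2) + e 375 * (1 + u^15)"
proof -
  have u: "u ^ n = e (30 * int n)" for n
    by (induction n) (simp_all add: e0 u_def add distrib_left)
  have 1: "e 126 * u^6 = e 306" "e 126 * u^12 = e 486" "e 126 * u^18 = e 666" "e 126 * u^24 = e 846"
    "e 220 * u^10 = e 520" "e 220 * u^20 = e 820" "e 375 * u^15 = e 825"
    by (simp_all add: u flip: add)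
  have "e 126 * (1 + u^6 + (u^6)^2 + (u^6)^3 + (u^6)^4) = e 126 + e 306 + e 486 + e 666 + e 846"
    "e 220 * (1 + u^10 + (u^10)^2) = e 220 + e 520 + e 820"
    "e 375 * (1 + u^15) = e 375 + e 825"
    by (simp_all add: distrib_left 1 flip: power_mult)
  moreover have "B_poly u = e 0 + e 30 + e 60 + e 180 + e 210 + e 240 + e 300 + e 330 + e 360 + e 390
     + e 480 + e 510 + e 540 + e 570 + e 660 + e 690 + e 750 + e 780 + e 840 + e 870"
    unfolding B_poly_def by (simp add: u e0) (simp add: u_def)
  ultimately show ?thesis by (simp add: B_set_def)
qed

text \<open>Turns the question whether a character value at j is 1 into divisibility of k by the
  numeral 900 div gcd 900 j.\<close>

lemma dvd_mult_iff_div_gcd: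
  fixes N k j :: int
  assumes "N \<noteq> 0"
  shows "N dvd k * j \<longleftrightarrow> N div gcd N j dvd k"
proof -
  define g where "g = gcd N j"
  have g: "g \<noteq> 0" "N = N div g * g" "j = j div g * g" using assms by (auto simp: g_def)
  have c: "coprime (N div g) (j div g)" unfolding g_def using assms by (intro div_gcd_coprime) auto
  have "N dvd k * j \<longleftrightarrow> N div g * g dvd k * (j div g) * g"
    using g by (metis mult.assoc)
  also have "\<dots> \<longleftrightarrow> N div g dvd k * (j div g)" using g(1) by simp
  also have "\<dots> \<longleftrightarrow> N div g dvd k" using c by (simp add: coprime_dvd_mult_left_iff)
  finally show ?thesis by (simp add: g_def)
qed

text \<open>The order of u is the product of those primes among 2, 3, 5 that do not divide k. If all
  three divide k, the term 20 dominates. Otherwise a zero sum determines the phases \<alpha>,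
  \<beta>, \<gamma> of the surviving progressions, and these values force p^2 to divide k for each p
  dividing k, against the assumption.\<close>

lemma sum_B_set_nonzero:
  fixes k :: int
  assumes "2 dvd k \<and> \<not> 4 dvd k \<or> 3 dvd k \<and> \<not> 9 dvd k \<or> 5 dvd k \<and> \<not> 25 dvd k \<or> 900 dvd k"
  shows "(\<Sum>b\<in>B_set. expo (of_int k / 900) (of_int b)) \<noteq> 0"
proof
  assume sum0: "(\<Sum>b\<in>B_set. expo (of_int k / 900) (of_int b)) = 0"
  define e where "e = (\<lambda>j::int. expo (of_int k / 900) (of_int j))"
  have add: "e (i + j) = e i * e j" for i j by (simp add: e_def expo_add)
  have e0: "e 0 = 1" by (simp add: e_def)
  have pow: "e i ^ n = e (int n * i)" for i n
    by (simp add: e_def expo_power)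
  have e1: "e j = 1 \<longleftrightarrow> 900 div gcd 900 j dvd k" for j
    using expo_frac_eq_1_iff[of 900 k j] dvd_mult_iff_div_gcd[of 900 k j] by (simp add: e_def)
  have gcds: "gcd 900 750 = (150::int)" "gcd 900 375 = (75::int)" "gcd 900 126 = (18::int)" "gcd 900 252 = (36::int)" "gcd 900 1125 = (225::int)" "gcd 900 220 = (20::int)" "gcd 900 720 = (180::int)" "gcd 900 360 = (180::int)" "gcd 900 420 = (60::int)" "gcd 900 100 = (100::int)" "gcd 900 225 = (225::int)"
    by code_simp+
  have d900: "2 dvd k" "3 dvd k" "5 dvd k" if "900 dvd k"
    using that by (auto elim!: dvd_trans[rotated])
  have nz: "e j \<noteq> 0" and n1: "norm (e j) = 1" for j by (simp_all add: e_def)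
  have cancel: "e (i + j) = e i \<longleftrightarrow> e j = 1" for i j using nz[of i] by (simp add: add)
  define u where "u = e 30"
  define \<alpha> where "\<alpha> = e 126"
  define \<beta> where "\<beta> = e 220"
  define \<gamma> where "\<gamma> = e 375"
  have S: "B_poly u + \<alpha> * (1 + u^6 + (u^6)^2 + (u^6)^3 + (u^6)^4)
    + \<beta> * (1 + u^10 + (u^10)^2) + \<gamma> * (1 + u^15) = 0"
    using sum0 sum_B_set[of e, OF add e0] by (simp add: e_def \<alpha>_def \<beta>_def \<gamma>_def u_def)
  have upow: "u ^ n = e (30 * int n)" for n by (simp add: u_def pow mult.commute)
  have u30: "u ^ 30 = 1" by (simp add: upow e1)
  have u15: "u ^ 15 = 1 \<longleftrightarrow> 2 dvd k" and u10: "u ^ 10 = 1 \<longleftrightarrow> 3 dvd k" and u6: "u ^ 6 = 1 \<longleftrightarrow> 5 dvd k"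
    by (simp_all add: upow e1)
  have s2: "1 + u^15 = (if 2 dvd k then 2 else 0)"
  proof (cases "2 dvd k")
    case False
    then show ?thesis using root_sum_zero(1)[of "u^15"] u15 u30 by (simp flip: power_mult)
  qed (use u15 in simp)
  have s3: "1 + u^10 + (u^10)^2 = (if 3 dvd k then 3 else 0)"
  proof (cases "3 dvd k")
    case False
    then show ?thesis using root_sum_zero(2)[of "u^10"] u10 u30 by (simp flip: power_mult)
  qed (use u10 in simp)
  have s5: "1 + u^6 + (u^6)^2 + (u^6)^3 + (u^6)^4 = (if 5 dvd k then 5 else 0)"
  proof (cases "5 dvd k")
    case False
    then show ?thesis using root_sum_zero(3)[of "u^6"] u6 u30 by (simp flip: power_mult)
  qed (use u6 in simp)
  note S = S[unfolded s2 s3 s5]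
  have u15m: "u^15 = - 1" if "\<not> 2 dvd k" using s2 that by (simp add: add_eq_0_iff)
  have mod: "u ^ m = u ^ n" if "e (30 * (int m - int n)) = 1" for m n
    using cancel[of "30 * int n" "30 * (int m - int n)"] that by (simp add: upow algebra_simps)
  \<comment> \<open>The assumption makes some prime divide k, so order 30 does not occur; 900 dvd k
    falls under the first case.\<close>
  consider "2 dvd k" "3 dvd k" "5 dvd k" | "2 dvd k" "3 dvd k" "\<not> 5 dvd k"
    | "2 dvd k" "\<not> 3 dvd k" "5 dvd k" | "\<not> 2 dvd k" "3 dvd k" "5 dvd k"
    | "2 dvd k" "\<not> 3 dvd k" "\<not> 5 dvd k" | "\<not> 2 dvd k" "3 dvd k" "\<not> 5 dvd k"
    | "\<not> 2 dvd k" "\<not> 3 dvd k" "5 dvd k"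
    using assms d900 by blast
  then show False
  proof cases
    case 1
    have "u = 1" using 1 by (simp add: u_def e1 gcds) presburger
    hence "20 + \<alpha> * 5 + \<beta> * 3 + \<gamma> * 2 = 0" using S 1 by (simp add: B_poly_def)
    hence "\<alpha> * 5 + \<beta> * 3 + \<gamma> * 2 = - 20" by algebra
    hence "20 = norm (\<alpha> * 5 + \<beta> * 3 + \<gamma> * 2)" by simp
    \<comment> \<open>Three phases with weights 5, 3, 2 reach modulus at most 10.\<close>
    also have "\<dots> \<le> norm (\<alpha> * 5) + norm (\<beta> * 3) + norm (\<gamma> * 2)"
      by (intro norm_triangle_le add_mono order_refl)
    also have "\<dots> = 10" by (simp add: norm_mult \<alpha>_def \<beta>_def \<gamma>_def n1)
    finally show False by simp
  next
    case 2
    have "u ^ 5 = 1" using 2 by (simp add: upow e1 gcds) presburger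
    moreover have "u \<noteq> 1" using 2 u6 by auto
    ultimately have "B_poly u = - 2 - 3 * u^4" by (rule B_poly_order5)
    with S 2 have S': "- 2 - 3 * u^4 + \<beta> * 3 + \<gamma> * 2 = 0" by simp
    \<comment> \<open>220 = 4 * 30 + 100.\<close>
    have t: "\<beta> = u^4 * e 100" by (simp add: \<beta>_def upow flip: add)
    have "e 100 ^ 3 = 1" using 2 by (simp add: pow e1 gcds)
    have "\<gamma>^2 = 1" using 2 by (simp add: \<gamma>_def pow e1 gcds) presburger
    then consider "\<gamma> = 1" | "\<gamma> = - 1" using power2_eq_1_iff by blast
    then show False
    proof cases
      case 1
      then have "3 * u^4 * (e 100 - 1) = 0" using S' t by algebra
      hence "e 100 = 1" by (simp add: upow nz)
      with 1 have "4 dvd k" "9 dvd k" by (simp_all add: \<gamma>_def e1 gcds) presburger?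
      with assms 2 d900 show False by blast
    next
      case m: 2
      then have "u^4 * (e 100 - 1) = 4 / 3" using S' t by algebra
      hence "norm (u^4 * (e 100 - 1)) = norm (4 / 3 :: complex)" by (simp only:)
      hence n: "norm (e 100 - 1) = 4 / 3" by (simp add: norm_mult norm_power u_def n1 norm_divide)
      hence "e 100 \<noteq> 1" by auto
      with root_sum_zero(2) \<open>e 100 ^ 3 = 1\<close> have "1 + e 100 + e 100 ^ 2 = 0" by blast
      \<comment> \<open>A cube root of unity other than 1 has distance sqrt 3 from 1, not
        4/3.\<close>
      hence "(e 100 - 1)^2 = - 3 * e 100" by algebra
      hence "norm (e 100 - 1) ^ 2 = 3" by (simp add: n1 norm_mult flip: norm_power)
      with n show False by (simp only: power2_eq_square)
    qed
  next
    case 3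
    have "u ^ 3 = 1" using 3 by (simp add: upow e1 gcds) presburger
    moreover have "u \<noteq> 1" using 3 u10 by auto
    ultimately have "B_poly u = 2 * u - 3" by (rule B_poly_order3)
    with S 3 have S': "2 * u - 3 + \<alpha> * 5 + \<gamma> * 2 = 0" by simp
    \<comment> \<open>Since 2 * 375 = 30 + 720, this makes \<gamma> a square root of u and thus a
      sixth root of unity.\<close>
    have "e 720 = 1" using 3 by (simp add: e1 gcds)
    hence u: "u = \<gamma>^2" using add[of 30 720] by (simp add: u_def \<gamma>_def pow)
    have "(\<gamma>^3)^2 = 1" using u \<open>u ^ 3 = 1\<close> by (simp flip: power_mult)
    then consider "\<gamma>^3 = 1" | "\<gamma>^3 = - 1" using power2_eq_1_iff by blast
    then show False
    proof cases
      case 1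
      have "\<gamma> \<noteq> 1" using u \<open>u \<noteq> 1\<close> by force
      with 1 root_sum_zero(2) have "1 + \<gamma> + \<gamma>^2 = 0" by blast
      hence "5 * (\<alpha> - 1) = 0" using S' u by algebra
      hence "\<alpha> = 1" by simp
      with 1 have "25 dvd k" "4 dvd k" by (simp_all add: \<alpha>_def \<gamma>_def pow e1 gcds) presburger
      with assms 3 d900 show False by blast
    next
      case m: 2
      have "\<gamma> + 1 \<noteq> 0" using u \<open>u \<noteq> 1\<close> by (auto simp: add_eq_0_iff2)
      moreover have "(\<gamma> + 1) * (\<gamma>^2 - \<gamma> + 1) = 0" using m by algebra
      ultimately have q: "\<gamma>^2 - \<gamma> + 1 = 0" by simp
      have c: "\<gamma> * cnj \<gamma> = 1" "\<alpha> * cnj \<alpha> = 1" by (simp_all add: norm_1_cnj \<gamma>_def \<alpha>_def n1)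
      have "\<gamma> * (\<gamma> + cnj \<gamma> - 1) = 0" using q c(1) by algebra
      hence g: "\<gamma> + cnj \<gamma> = 1" using c by auto
      \<comment> \<open>For a primitive sixth root of unity \<gamma> the squared modulus of 5 - 4
        \<gamma> is 41 - 20 = 21, while that of 5 \<alpha> is 25.\<close>
      have a: "5 * \<alpha> = 5 - 4 * \<gamma>" using S' u q by algebra
      hence "cnj (5 * \<alpha>) = cnj (5 - 4 * \<gamma>)" by simp
      hence "5 * cnj \<alpha> = 5 - 4 * cnj \<gamma>" by simp
      with a g c have "(25::complex) = 21" by algebra
      thus False by simp
    qed
  next
    case 4
    have "u = - 1"
    proof -
      have "u^15 = u^1" by (rule mod) (use 4 in \<open>simp add: e1 gcds\<close>, presburger?)
      thus ?thesis using u15m 4 by simp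
    qed
    from B_poly_order2[OF this] S 4 have S': "2 + \<alpha> * 5 + \<beta> * 3 = 0" by simp
    hence S'': "2 + cnj \<alpha> * 5 + cnj \<beta> * 3 = 0"
      by (metis complex_cnj_add complex_cnj_mult complex_cnj_numeral complex_cnj_zero)
    have c: "\<beta> * cnj \<beta> = 1" "\<alpha> * cnj \<alpha> = 1" by (simp_all add: norm_1_cnj \<beta>_def \<alpha>_def n1)
    \<comment> \<open>From 25 = |2 + 3 \<beta>|^2 = 13 + 6 (\<beta> + cnj \<beta>): equality in the
      triangle inequality forces \<beta> = 1.\<close>
    have "6 * (\<beta> + cnj \<beta> - 2) = 0" using S' S'' c by algebra
    hence "(\<beta> - 1)^2 = 0" using c(1) by algebra
    hence b: "\<beta> = 1" by simp
    hence "5 * (\<alpha> + 1) = 0" using S' by algebra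
    \<comment> \<open>The square is \<open>e 252\<close>, and 900 / gcd 900 252 = 25.\<close>
    hence "\<alpha>^2 = 1" by (simp add: add_eq_0_iff2)
    with b have "25 dvd k" "9 dvd k" by (simp_all add: \<alpha>_def \<beta>_def pow e1 gcds) presburger+
    with assms 4 d900 show False by blast
  next
    case 5
    have "u ^ 15 = 1" using 5 u15 by simp
    moreover have "u ^ 5 \<noteq> 1" "u ^ 3 \<noteq> 1" using 5 by (simp_all add: upow e1 gcds) presburger+
    ultimately have "B_poly u = - 2 * u^5" by (rule B_poly_order15)
    with S 5 have "\<gamma> = u^5" by simp
    \<comment> \<open>375 = 5 * 30 + 225.\<close>
    hence "e 225 = 1" using cancel[of 150 225] by (simp add: \<gamma>_def upow)
    hence "4 dvd k" by (simp add: e1 gcds)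
    with assms 5 d900 show False by blast
  next
    case 6
    have "u^15 = u^5" by (rule mod) (use 6 in \<open>simp add: e1 gcds\<close>, presburger?)
    moreover have "u \<noteq> - 1"
    proof
      assume "u = - 1"
      hence "u ^ 2 = 1" by simp
      thus False using 6 by (simp add: upow e1 gcds) presburger
    qed
    ultimately have "B_poly u = - 3 * u^4" using B_poly_order10 u15m 6 by simp
    with S 6 have "\<beta> = u^4" by simp
    hence "e 100 = 1" using cancel[of 120 100] by (simp add: \<beta>_def upow)
    hence "9 dvd k" by (simp add: e1 gcds)
    with assms 6 d900 show False by blast
  next
    case 7
    have "u^15 = u^3" by (rule mod) (use 7 in \<open>simp add: e1 gcds\<close>, presburger?)
    moreover have "u \<noteq> - 1"
    proof
      assume "u = - 1"
      hence "u ^ 2 = 1" by simp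
      thus False using 7 by (simp add: upow e1 gcds) presburger
    qed
    ultimately have "B_poly u = 5" using B_poly_order6 u15m 7 by simp
    with S 7 have "5 + \<alpha> * 5 = 0" by simp
    hence "5 * (\<alpha> + 1) = 0" by algebra
    hence "\<alpha>^2 = 1" by (simp add: add_eq_0_iff2)
    hence "25 dvd k" by (simp add: \<alpha>_def pow e1 gcds)
    with assms 7 d900 show False by blast
  qed
qed

text \<open>A finite check over all pairs; the alternative 900 dvd k absorbs the diagonal.\<close>

lemma B_set_differences:
  assumes "a \<in> B_set" "b \<in> B_set"
  defines "k \<equiv> a - b"
  shows "2 dvd k \<and> \<not> 4 dvd k \<or> 3 dvd k \<and> \<not> 9 dvd k \<or> 5 dvd k \<and> \<not> 25 dvd k \<or> 900 dvd k"
proof -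
  have "\<forall>a\<in>B_set. \<forall>b\<in>B_set. 2 dvd a - b \<and> \<not> 4 dvd a - b \<or> 3 dvd a - b \<and> \<not> 9 dvd a - b
     \<or> 5 dvd a - b \<and> \<not> 25 dvd a - b \<or> 900 dvd a - b"
    unfolding B_set_def by code_simp
  with assms show ?thesis by blast
qed

lemma B_set_incong:
  assumes "a \<in> B_set" "b \<in> B_set" "900 dvd a - b"
  shows "a = b"
proof -
  have "0 \<le> c \<and> c < 900" if "c \<in> B_set" for c using that by (auto simp: B_set_def)
  from this[OF assms(1)] this[OF assms(2)] have "\<bar>a - b\<bar> < 900" by linarith
  with assms(3) show ?thesis using zdvd_imp_le[of 900 "\<bar>a - b\<bar>"] by auto
qed

theorem theorem4p2:
  shows "universal_spectrum Lambda_B T_B"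
proof -
  have "universal_spectrum {real 900 * of_int n + of_int l | n l. l \<in> B_set}
      {of_int n + of_int b / real 900 | n b. b \<in> B_set}"
  proof (rule universal_spectrum_of_nonvanishing)
    show "finite B_set" "card B_set * card B_set = 900" by (simp_all add: B_set_def)
    show "b = b'" if "b \<in> B_set" "b' \<in> B_set" "int 900 dvd b - b'" for b b'
      using B_set_incong[OF that(1,2)] that(3) by simp
    \<comment> \<open>The same fact serves for the spectrum, as L = B.\<close>
    thus "b = b'" if "b \<in> B_set" "b' \<in> B_set" "int 900 dvd b - b'" for b b'
      using that .
    show "(\<Sum>b\<in>B_set. expo (of_int (l - l') / real 900) (of_int b)) \<noteq> 0"
      if "l \<in> B_set" "l' \<in> B_set" for l l'
      using sum_B_set_nonzero[OF B_set_differences[OF that]] by simp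
  qed simp
  thus ?thesis by (simp add: Lambda_B_def T_B_def)
qed

end
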